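(* Let $n\geq 1$, let $[m]=(m_1,\ldots,m_n)\in\mathbb{Z}_{>1}^n$ be a multi-index, and let $Q(\underline{x},y)=y^r+\sum_{i=0}^{r-1}a_i(\underline{x})y^i\in\mathbb{C}[\underline{x}][y]$ be a monic polynomial in $y$ of degree $r\geq 2$, where $\mathbb{C}[\underline{x}]=\mathbb{C}[x_1,\ldots,x_n]$ and $a_i(\underline{x})\in\mathbb{C}[\underline{x}]$. Let $X_{[m],Q}\subset\mathbb{C}^{n+2}=\mathrm{Spec}(\mathbb{C}[x_1,\ldots,x_n,y,z])$ be the affine variety with equation $$x_1^{m_1}\cdots x_n^{m_n}z-Q(\underline{x},y)=0.$$ Then the Makar-Limanov invariant $\mathrm{ML}(X_{[m],Q})$ is isomorphic to $\mathbb{C}[x_1,\ldots,x_n]$.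
   Context: The Makar-Limanov invariant $\mathrm{ML}(X)$ of a complex affine variety $X=\mathrm{Spec}(B)$ is the subring of $B$ consisting of the regular functions on $X$ that are invariant under all algebraic actions of the additive group $\mathbb{C}_+$ on $X$. Algebraic $\mathbb{C}_+$-actions on $X$ correspond bijectively to locally nilpotent $\mathbb{C}$-derivations $\partial$ of $B$ (derivations such that every $b\in B$ is killed by some power of $\partial$), the ring of invariants being $\mathrm{Ker}(\partial)$; thus $\mathrm{ML}(X)$ is the intersection of the kernels of all locally nilpotent $\mathbb{C}$-derivations of $B$. *)

theory Defs
  imports
    "HOL-Library.Poly_Mapping"
    "HOL-Algebra.QuotRing"
    "HOL-Algebra.Algebraic_Closure_Type"
    "HOL-Computational_Algebra.Polynomial"
begin

text \<open>
  The polynomial ring over the complex numbers in variables indexed by the type \<open>'n\<close>: finitely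
  supported functions from exponent vectors to coefficients, multiplied by convolution. For a finite
  \<open>'n\<close> with \<open>CARD('n) = n\<close> this is the ring of polynomials in \<open>x\<^sub>1, \<dots>, x\<^sub>n\<close>.
\<close>

type_synonym 'n cpoly = "('n \<Rightarrow>\<^sub>0 nat) \<Rightarrow>\<^sub>0 complex"

definition cconst :: "complex \<Rightarrow> 'n cpoly"
  where "cconst c = Poly_Mapping.single 0 c"

definition cvar :: "'n \<Rightarrow> 'n cpoly"
  where "cvar i = Poly_Mapping.single (Poly_Mapping.single i 1) 1"

text \<open>
  A complex algebra is a ring \<open>A\<close> together with its structure homomorphism \<open>\<iota>\<close> from the
  complex numbers.
\<close>

definition complex_derivation ::
    "(complex \<Rightarrow> 'a) \<Rightarrow> ('a, 'b) ring_scheme \<Rightarrow> ('a \<Rightarrow> 'a) \<Rightarrow> bool"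
  where "complex_derivation \<iota> A \<delta> \<longleftrightarrow>
    \<delta> \<in> carrier A \<rightarrow> carrier A \<and>
    (\<forall>a\<in>carrier A. \<forall>b\<in>carrier A. \<delta> (a \<oplus>\<^bsub>A\<^esub> b) = \<delta> a \<oplus>\<^bsub>A\<^esub> \<delta> b) \<and>
    (\<forall>c. \<forall>a\<in>carrier A. \<delta> (\<iota> c \<otimes>\<^bsub>A\<^esub> a) = \<iota> c \<otimes>\<^bsub>A\<^esub> \<delta> a) \<and>
    (\<forall>a\<in>carrier A. \<forall>b\<in>carrier A.
      \<delta> (a \<otimes>\<^bsub>A\<^esub> b) = (\<delta> a \<otimes>\<^bsub>A\<^esub> b) \<oplus>\<^bsub>A\<^esub> (a \<otimes>\<^bsub>A\<^esub> \<delta> b))"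

definition locally_nilpotent :: "('a, 'b) ring_scheme \<Rightarrow> ('a \<Rightarrow> 'a) \<Rightarrow> bool"
  where "locally_nilpotent A \<delta> \<longleftrightarrow> (\<forall>a\<in>carrier A. \<exists>k. (\<delta> ^^ k) a = \<zero>\<^bsub>A\<^esub>)"

definition makar_limanov :: "(complex \<Rightarrow> 'a) \<Rightarrow> ('a, 'b) ring_scheme \<Rightarrow> 'a set"
  where "makar_limanov \<iota> A = {a \<in> carrier A.
    \<forall>\<delta>. complex_derivation \<iota> A \<delta> \<and> locally_nilpotent A \<delta> \<longrightarrow> \<delta> a = \<zero>\<^bsub>A\<^esub>}"

text \<open>
  The ambient ring \<open>\<complex>[x\<^sub>1, \<dots>, x\<^sub>n, y, z]\<close> is the iterated polynomial ring
  \<open>'n cpoly poly poly\<close>: the outer variable is \<open>z\<close>, the inner one is \<open>y\<close>. Accordingly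
  \<open>[:0, 1:]\<close> below is \<open>z\<close>, and \<open>[:p:]\<close> views a polynomial \<open>p\<close> as constant in one
  further variable.
\<close>

definition danielewski_eq :: "('n::finite \<Rightarrow> nat) \<Rightarrow> 'n cpoly poly \<Rightarrow> 'n cpoly poly poly"
  where "danielewski_eq m Q = [:[:\<Prod>i\<in>UNIV. cvar i ^ m i:]:] * [:0, 1:] - [:Q:]"

definition danielewski_ideal :: "('n::finite \<Rightarrow> nat) \<Rightarrow> 'n cpoly poly \<Rightarrow> 'n cpoly poly poly set"
  where "danielewski_ideal m Q = PIdl\<^bsub>ring_of_type_algebra\<^esub> (danielewski_eq m Q)"

definition danielewski_ring ::
    "('n::finite \<Rightarrow> nat) \<Rightarrow> 'n cpoly poly \<Rightarrow> 'n cpoly poly poly set ring"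
  where "danielewski_ring m Q = ring_of_type_algebra Quot danielewski_ideal m Q"

definition danielewski_const ::
    "('n::finite \<Rightarrow> nat) \<Rightarrow> 'n cpoly poly \<Rightarrow> complex \<Rightarrow> 'n cpoly poly poly set"
  where "danielewski_const m Q c =
    danielewski_ideal m Q +>\<^bsub>ring_of_type_algebra\<^esub> [:[:cconst c:]:]"

lemma danielewski_ideal: "ideal (danielewski_ideal m Q) ring_of_type_algebra"
  unfolding danielewski_ideal_def
  by (rule cring.cgenideal_ideal[OF cring_from_type_algebra]) (simp add: ring_of_type_algebra_def)

lemma cring_danielewski_ring: "cring (danielewski_ring m Q)"
  unfolding danielewski_ring_def
  by (rule ideal.quotient_is_cring[OF danielewski_ideal cring_from_type_algebra])

lemma danielewski_const_hom: 
  "danielewski_const m Q \<in> ring_hom ring_of_type_algebra (danielewski_ring m Q)"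
proof -
  have "(\<lambda>c. [:[:cconst c:]:]) \<in> ring_hom ring_of_type_algebra
      (ring_of_type_algebra :: 'a cpoly poly poly ring)"
    by (rule ring_hom_memI)
      (auto simp: ring_of_type_algebra_def cconst_def mult_single single_add one_pCons)
  from ring_hom_trans[OF this ideal.rcos_ring_hom[OF danielewski_ideal]] show ?thesis
    by (simp add: danielewski_const_def[abs_def] danielewski_ring_def comp_def)
qed

end

theory Submission
  imports Defs "HOL-Library.Countable"
begin

text \<open>
  The coordinate ring \<open>B\<close> embeds into the Laurent ring \<open>\<complex>[x\<^sup>\<plusminus>\<^sup>1, y\<^sup>\<plusminus>\<^sup>1]\<close> by
  \<open>z \<mapsto> x\<^sup>-\<^sup>m Q\<close>. Modulo the equation every polynomial is a unique \<open>\<complex>[x]\<close>-combination of the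
  \<open>y\<^sup>l z\<^sup>k\<close> with \<open>l < r\<close>, whose \<open>y\<close>-degrees \<open>r k + l\<close> are pairwise distinct. Hence the leading
  exponent \<open>(v, u)\<close> of an element of \<open>B\<close>, for the lexicographic order in which \<open>y\<close> dominates,
  satisfies \<open>v \<ge> 0\<close> and \<open>u\<^sub>i \<ge> - m\<^sub>i (v div r)\<close>.

  A locally nilpotent derivation \<open>\<delta>\<close> of \<open>B\<close> extends to \<open>\<Sum>\<^sub>k f\<^sub>k E\<^sub>k\<close> on the Laurent ring, with Euler
  operators \<open>E\<^sub>k\<close>. Let \<open>w\<close> be the largest exponent occurring in the \<open>f\<^sub>k\<close>. The leading part of \<open>\<delta>\<close>
  shifts exponents by \<open>w\<close> and multiplies the monomial with exponent \<open>u\<close> by a linear function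
  \<open>\<sigma>(u)\<close>, so nilpotency forces \<open>\<sigma>(u) \<in> - \<nat> \<sigma>(w)\<close> on \<open>x\<^sub>i\<close>, \<open>y\<close> and \<open>z\<close>. Together with the
  constraints on leading exponents and \<open>m\<^sub>i, r \<ge> 2\<close>, this leaves only \<open>y\<close>-degree \<open>-1\<close> for \<open>\<delta>\<close>; as
  elements of \<open>B\<close> have nonnegative \<open>y\<close>-degree, \<open>\<delta> x\<^sub>i = 0\<close>. Conversely the derivation
  \<open>x\<^sup>m \<partial>/\<partial>y\<close> of \<open>B\<close> has kernel \<open>\<complex>[x]\<close>.
\<close>

section \<open>Monomials and leading exponents\<close>

lemma poly_mapping_sum_single:
  "(\<Sum>a\<in>Poly_Mapping.keys p. Poly_Mapping.single a (Poly_Mapping.lookup p a)) = p"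
  by (rule poly_mapping_eqI) (simp add: lookup_sum lookup_single when_def in_keys_iff)

lemma poly_mapping_single_induct [case_names single add]:
  fixes p :: "'a \<Rightarrow>\<^sub>0 'b::comm_monoid_add"
  assumes single: "\<And>a c. P (Poly_Mapping.single a c)"
    and add: "\<And>p q. P p \<Longrightarrow> P q \<Longrightarrow> P (p + q)"
  shows "P p"
proof -
  have "P (\<Sum>a\<in>A. Poly_Mapping.single a (Poly_Mapping.lookup p a))" if "finite A" for A
    using that
  proof induction
    case empty
    then show ?case using single[of undefined 0] by simp
  next
    case (insert a A)
    then show ?case by (simp add: single add)
  qed
  from this[OF finite_keys, of p] show ?thesis
    by (simp add: poly_mapping_sum_single)
qed

lemma lookup_times:
  fixes p q :: "'a::monoid_add \<Rightarrow>\<^sub>0 'b::semiring_0"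
  shows "Poly_Mapping.lookup (p * q) k =
    (\<Sum>a\<in>Poly_Mapping.keys p. \<Sum>b\<in>Poly_Mapping.keys q.
      if a + b = k then Poly_Mapping.lookup p a * Poly_Mapping.lookup q b else 0)"
proof -
  have "p * q = (\<Sum>a\<in>Poly_Mapping.keys p. Poly_Mapping.single a (Poly_Mapping.lookup p a)) *
      (\<Sum>b\<in>Poly_Mapping.keys q. Poly_Mapping.single b (Poly_Mapping.lookup q b))"
    by (simp only: poly_mapping_sum_single)
  also have "\<dots> = (\<Sum>a\<in>Poly_Mapping.keys p. \<Sum>b\<in>Poly_Mapping.keys q.
      Poly_Mapping.single (a + b) (Poly_Mapping.lookup p a * Poly_Mapping.lookup q b))"
    by (simp add: sum_product mult_single)
  finally show ?thesis
    by (simp add: lookup_sum lookup_single when_def)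
qed

lemma keys_times_atMost:
  fixes p q :: "'a::ordered_comm_monoid_add \<Rightarrow>\<^sub>0 'b::semiring_0"
  assumes "Poly_Mapping.keys p \<subseteq> {..a}" "Poly_Mapping.keys q \<subseteq> {..b}"
  shows "Poly_Mapping.keys (p * q) \<subseteq> {..a + b}"
  using assms keys_mult[of p q] by (fastforce intro: add_mono)

text \<open>The order is compatible with addition, so \<open>a' + b' = a + b\<close> with
  \<open>a' \<le> a\<close> and \<open>b' \<le> b\<close> forces equality in both, and a single
  product survives. The bounds \<open>a\<close> and \<open>b\<close> need not be attained.\<close>

lemma lookup_times_top:
  fixes p q :: "'a::linordered_ab_group_add \<Rightarrow>\<^sub>0 'b::semiring_0"
  assumes p: "Poly_Mapping.keys p \<subseteq> {..a}" and q: "Poly_Mapping.keys q \<subseteq> {..b}"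
  shows "Poly_Mapping.lookup (p * q) (a + b) = Poly_Mapping.lookup p a * Poly_Mapping.lookup q b"
proof -
  have eq: "a' = a \<and> b' = b" if "a' \<in> Poly_Mapping.keys p" "b' \<in> Poly_Mapping.keys q"
      "a' + b' = a + b" for a' b'
    using that p q by (smt (verit) add_le_less_mono add_less_le_mono atMost_iff less_irrefl order_le_less subsetD)
  have "Poly_Mapping.lookup (p * q) (a + b) =
    (\<Sum>a'\<in>Poly_Mapping.keys p. \<Sum>b'\<in>Poly_Mapping.keys q.
      if a' = a then if b' = b then Poly_Mapping.lookup p a * Poly_Mapping.lookup q b else 0 else 0)"
    unfolding lookup_times by (intro sum.cong refl) (auto dest: eq)
  also have "\<dots> = (\<Sum>a'\<in>Poly_Mapping.keys p. if a' = a then \<Sum>b'\<in>Poly_Mapping.keys q.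
      if b' = b then Poly_Mapping.lookup p a * Poly_Mapping.lookup q b else 0 else 0)"
    by (intro sum.cong refl) auto
  also have "\<dots> = Poly_Mapping.lookup p a * Poly_Mapping.lookup q b"
    by (auto simp: sum.delta in_keys_iff)
  finally show ?thesis .
qed

section \<open>Derivations of the Laurent polynomial ring\<close>

text \<open>This is \<open>t_k d/dt_k\<close> for the \<open>k\<close>-th coordinate
  \<open>t_k\<close>. It is diagonal on monomials and therefore preserves exponents.\<close>

definition euler ::
    "'k \<Rightarrow> (('k \<Rightarrow>\<^sub>0 int) \<Rightarrow>\<^sub>0 'b::comm_ring_1) \<Rightarrow> ('k \<Rightarrow>\<^sub>0 int) \<Rightarrow>\<^sub>0 'b"
  where "euler k = Poly_Mapping.mapp (\<lambda>u c. of_int (Poly_Mapping.lookup u k) * c)"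

lemma lookup_euler:
  "Poly_Mapping.lookup (euler k b) u = of_int (Poly_Mapping.lookup u k) * Poly_Mapping.lookup b u"
  by (simp add: euler_def lookup_mapp when_def in_keys_iff)

lemma keys_euler_subset: "Poly_Mapping.keys (euler k b) \<subseteq> Poly_Mapping.keys b"
  by (auto simp: in_keys_iff lookup_euler)

lemma euler_add: "euler k (b + c) = euler k b + euler k c"
  by (rule poly_mapping_eqI) (simp add: lookup_euler lookup_add algebra_simps)

lemma euler_single:
  "euler k (Poly_Mapping.single u c) = Poly_Mapping.single u (of_int (Poly_Mapping.lookup u k) * c)"
  by (rule poly_mapping_eqI) (simp add: lookup_euler lookup_single when_def)

lemma euler_times: "euler k (b * c) = euler k b * c + b * euler k c"
proof (induction b rule: poly_mapping_single_induct)
  case (single u d)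
  show ?case
  proof (induction c rule: poly_mapping_single_induct)
    case (single v e)
    show ?case
      by (simp add: euler_single mult_single lookup_add flip: single_add)
        (simp add: algebra_simps)
  qed (simp add: euler_add algebra_simps)
qed (simp add: euler_add algebra_simps)

text \<open>Coefficients are taken relative to Euler operators rather than partial derivatives, so
  that a term of exponent \<open>w\<close> in \<open>f k\<close> shifts every exponent by exactly
  \<open>w\<close>.\<close>

definition vfield ::
    "'k set \<Rightarrow> ('k \<Rightarrow> ('k \<Rightarrow>\<^sub>0 int) \<Rightarrow>\<^sub>0 'b::comm_ring_1) \<Rightarrow> (('k \<Rightarrow>\<^sub>0 int) \<Rightarrow>\<^sub>0 'b) \<Rightarrow> ('k \<Rightarrow>\<^sub>0 int) \<Rightarrow>\<^sub>0 'b"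
  where "vfield K f b = (\<Sum>k\<in>K. f k * euler k b)"

text \<open>The scalar by which the component of exponent \<open>w\<close> of the field multiplies
  the monomial with exponent \<open>u\<close>. It is additive in \<open>u\<close>.\<close>

definition symbol ::
    "'k set \<Rightarrow> ('k \<Rightarrow> ('k \<Rightarrow>\<^sub>0 int) \<Rightarrow>\<^sub>0 'b::comm_ring_1) \<Rightarrow> ('k \<Rightarrow>\<^sub>0 int) \<Rightarrow> ('k \<Rightarrow>\<^sub>0 int) \<Rightarrow> 'b"
  where "symbol K f w u = (\<Sum>k\<in>K. of_int (Poly_Mapping.lookup u k) * Poly_Mapping.lookup (f k) w)"

lemma vfield_add: "vfield K f (b + c) = vfield K f b + vfield K f c"
  by (simp add: vfield_def euler_add algebra_simps sum.distrib)

lemma vfield_times: "vfield K f (b * c) = vfield K f b * c + b * vfield K f c"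
  by (simp add: vfield_def euler_times algebra_simps sum.distrib sum_distrib_left sum_distrib_right)

lemma symbol_add: "symbol K f w (u + v) = symbol K f w u + symbol K f w v"
  by (simp add: symbol_def lookup_add algebra_simps sum.distrib)

lemma vfield_top:
  fixes b :: "('k::linorder \<Rightarrow>\<^sub>0 int) \<Rightarrow>\<^sub>0 'b::comm_ring_1"
  assumes f: "\<And>k. k \<in> K \<Longrightarrow> Poly_Mapping.keys (f k) \<subseteq> {..w}"
    and b: "Poly_Mapping.keys b \<subseteq> {..u}"
  shows "Poly_Mapping.keys (vfield K f b) \<subseteq> {..w + u}"
    and "Poly_Mapping.lookup (vfield K f b) (w + u) = symbol K f w u * Poly_Mapping.lookup b u"
proof -
  have E: "Poly_Mapping.keys (euler k b) \<subseteq> {..u}" for k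
    using keys_euler_subset b by fastforce
  show "Poly_Mapping.keys (vfield K f b) \<subseteq> {..w + u}"
    unfolding vfield_def using keys_times_atMost[OF f E]
    by (intro order.trans[OF keys_sum]) blast
  show "Poly_Mapping.lookup (vfield K f b) (w + u) = symbol K f w u * Poly_Mapping.lookup b u"
    by (simp add: vfield_def lookup_sum lookup_times_top[OF f E] lookup_euler symbol_def
        sum_distrib_left mult_ac)
qed

text \<open>While the symbol at the current leading exponent is non-zero, each application moves
  that exponent by \<open>w\<close> and adds \<open>symbol K f w w\<close> to the symbol. Nilpotency
  makes the symbol vanish after some number \<open>i\<close> of moves.\<close>

lemma vfield_nilpotent_top:
  fixes b :: "('k::linorder \<Rightarrow>\<^sub>0 int) \<Rightarrow>\<^sub>0 'b::idom"
  assumes f: "\<And>k. k \<in> K \<Longrightarrow> Poly_Mapping.keys (f k) \<subseteq> {..w}"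
    and b: "Poly_Mapping.keys b \<subseteq> {..u}" "Poly_Mapping.lookup b u \<noteq> 0"
    and nil: "(vfield K f ^^ n) b = 0"
  shows "\<exists>i. symbol K f w u + of_nat i * symbol K f w w = 0"
  using b nil
proof (induction n arbitrary: b u)
  case (Suc n)
  show ?case
  proof (cases "symbol K f w u = 0")
    case True
    then show ?thesis by (intro exI[of _ 0]) simp
  next
    case False
    have "(vfield K f ^^ n) (vfield K f b) = 0"
      using Suc.prems(3) by (simp add: funpow_swap1)
    with False Suc.IH[of "vfield K f b" "w + u"] Suc.prems vfield_top[of K f w b u, OF f]
    obtain i where "symbol K f w (w + u) + of_nat i * symbol K f w w = 0"
      by auto
    then show ?thesis
      by (intro exI[of _ "Suc i"]) (simp add: symbol_add algebra_simps)
  qed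
qed auto

section \<open>The embedding into the Laurent polynomial ring\<close>

locale algebra_hom =
  fixes h :: "'a::comm_ring_1 \<Rightarrow> 'b::comm_ring_1"
  assumes hom_add: "h (a + b) = h a + h b"
    and hom_mult: "h (a * b) = h a * h b"
    and hom_one: "h 1 = 1"
begin

lemma hom_zero: "h 0 = 0"
  using hom_add[of 0 0] by simp

lemma hom_uminus: "h (- a) = - h a"
  using hom_add[of a "- a"] by (simp add: hom_zero eq_neg_iff_add_eq_0 add.commute)

lemma hom_diff: "h (a - b) = h a - h b"
  using hom_add[of a "- b"] by (simp add: hom_uminus)

lemma hom_power: "h (a ^ n) = h a ^ n"
  by (induction n) (simp_all add: hom_one hom_mult)

lemma hom_prod: "h (\<Prod>i\<in>A. f i) = (\<Prod>i\<in>A. h (f i))"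
  by (induction A rule: infinite_finite_induct) (simp_all add: hom_one hom_mult)

definition eval :: "'b \<Rightarrow> 'a poly \<Rightarrow> 'b"
  where "eval y p = poly (map_poly h p) y"

lemma eval_zero [simp]: "eval y 0 = 0"
  by (simp add: eval_def)

lemma eval_pCons [simp]: "eval y (pCons a p) = h a + y * eval y p"
  by (cases "a = 0 \<and> p = 0") (auto simp: eval_def map_poly_pCons hom_zero)

lemma eval_add: "eval y (p + q) = eval y p + eval y q"
  by (induction p q rule: poly_induct2) (simp_all add: hom_add algebra_simps)

lemma eval_smult: "eval y (Polynomial.smult a p) = h a * eval y p"
  by (induction p) (simp_all add: hom_mult algebra_simps)

lemma eval_mult: "eval y (p * q) = eval y p * eval y q"
  by (induction p) (simp_all add: eval_add eval_smult hom_zero algebra_simps)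

text \<open>Evaluation extends a homomorphism by one variable, and the result is again an instance
  of the locale. The construction is iterated below, first for \<open>y\<close> and then for
  \<open>z\<close>.\<close>

lemma algebra_hom_eval: "algebra_hom (eval y)"
  by unfold_locales (simp_all add: eval_add eval_mult one_pCons hom_one)

end

text \<open>The type of the variables need not carry an order; the injection \<open>to_nat\<close>
  borrows the one of \<open>nat\<close>. The shift by one reserves the index
  \<open>0\<close>.\<close>

definition xidx :: "'n::finite \<Rightarrow> nat"
  where "xidx i = Suc (to_nat i)"

lemma xidx_eq_iff [simp]: "xidx i = xidx j \<longleftrightarrow> i = j"
  by (simp add: xidx_def)

lemma xidx_neq_0 [simp]: "xidx i \<noteq> 0" "0 \<noteq> xidx i"
  by (simp_all add: xidx_def)

text \<open>
  Exponents of the Laurent ring are indexed by \<open>nat\<close>: the index \<open>0\<close> belongs to \<open>y\<close> and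
  \<open>xidx i\<close> to \<open>x\<^sub>i\<close>. The order on \<open>nat \<Rightarrow>\<^sub>0 int\<close> is lexicographic with smaller indices
  dominant, so that the \<open>y\<close>-degree is compared first.
\<close>

type_synonym laurent = "(nat \<Rightarrow>\<^sub>0 int) \<Rightarrow>\<^sub>0 complex"

definition xexp :: "('n::finite \<Rightarrow> int) \<Rightarrow> nat \<Rightarrow>\<^sub>0 int"
  where "xexp e = (\<Sum>i\<in>UNIV. Poly_Mapping.single (xidx i) (e i))"

lemma lookup_xexp [simp]:
  "Poly_Mapping.lookup (xexp e) 0 = 0" "Poly_Mapping.lookup (xexp e) (xidx i) = e i"
  by (simp_all add: xexp_def lookup_sum lookup_single when_def)

lemma xexp_add: "xexp (\<lambda>i. d i + e i) = xexp d + xexp e"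
  by (simp add: xexp_def single_add sum.distrib)

lemma xexp_zero [simp]: "xexp (\<lambda>i. 0) = 0"
  by (simp add: xexp_def)

abbreviation embed_exp :: "('n::finite \<Rightarrow>\<^sub>0 nat) \<Rightarrow> nat \<Rightarrow>\<^sub>0 int"
  where "embed_exp e \<equiv> xexp (\<lambda>i. int (Poly_Mapping.lookup e i))"

lemma embed_exp_add: "embed_exp (d + e) = embed_exp d + embed_exp e"
  by (simp add: lookup_add xexp_add)

lemma embed_exp_eq_iff: "embed_exp d = embed_exp e \<longleftrightarrow> d = e"
  by (metis lookup_xexp(2) of_nat_eq_iff poly_mapping_eqI)

lemma embed_exp_single: "embed_exp (Poly_Mapping.single i k) = Poly_Mapping.single (xidx i) (int k)"
proof -
  have "embed_exp (Poly_Mapping.single i k) =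
      (\<Sum>j\<in>UNIV. if j = i then Poly_Mapping.single (xidx i) (int k) else 0)"
    unfolding xexp_def by (intro sum.cong refl) (auto simp: lookup_single when_def)
  then show ?thesis by simp
qed

definition embed_coeff :: "'n::finite cpoly \<Rightarrow> laurent"
  where "embed_coeff p =
    (\<Sum>e\<in>Poly_Mapping.keys p. Poly_Mapping.single (embed_exp e) (Poly_Mapping.lookup p e))"

lemma embed_coeff_superset:
  assumes "finite A" "Poly_Mapping.keys p \<subseteq> A"
  shows "embed_coeff p = (\<Sum>e\<in>A. Poly_Mapping.single (embed_exp e) (Poly_Mapping.lookup p e))"
  unfolding embed_coeff_def using assms
  by (intro sum.mono_neutral_left) (auto simp: in_keys_iff)

lemma embed_coeff_single:
  "embed_coeff (Poly_Mapping.single e c) = Poly_Mapping.single (embed_exp e) c"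
  by (subst embed_coeff_superset[of "{e}"]) auto

lemma embed_coeff_add: "embed_coeff (p + q) = embed_coeff p + embed_coeff q"
proof -
  let ?A = "Poly_Mapping.keys p \<union> Poly_Mapping.keys q"
  have "embed_coeff (p + q) =
      (\<Sum>e\<in>?A. Poly_Mapping.single (embed_exp e) (Poly_Mapping.lookup (p + q) e))"
    by (rule embed_coeff_superset) (auto simp: keys_add)
  also have "\<dots> = (\<Sum>e\<in>?A. Poly_Mapping.single (embed_exp e) (Poly_Mapping.lookup p e)) +
      (\<Sum>e\<in>?A. Poly_Mapping.single (embed_exp e) (Poly_Mapping.lookup q e))"
    by (simp add: lookup_add single_add sum.distrib)
  also have "\<dots> = embed_coeff p + embed_coeff q"
    by (subst (1 2) embed_coeff_superset[of ?A]) auto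
  finally show ?thesis .
qed

lemma embed_coeff_mult: "embed_coeff (p * q) = embed_coeff p * embed_coeff q"
proof (induction p rule: poly_mapping_single_induct)
  case (single d c)
  show ?case
  proof (induction q rule: poly_mapping_single_induct)
    case (single e c')
    show ?case
      by (simp only: mult_single embed_coeff_single embed_exp_add)
  qed (simp add: embed_coeff_add algebra_simps)
qed (simp add: embed_coeff_add algebra_simps)

interpretation embed_coeff: algebra_hom embed_coeff
  by unfold_locales
    (simp_all add: embed_coeff_add embed_coeff_mult embed_coeff_single flip: single_one)

lemma lookup_embed_coeff:
  "Poly_Mapping.lookup (embed_coeff p) (embed_exp e) = Poly_Mapping.lookup p e"
  by (simp add: embed_coeff_def lookup_sum lookup_single when_def embed_exp_eq_iff in_keys_iff)

lemma keys_embed_coeff_subset: "Poly_Mapping.keys (embed_coeff p) \<subseteq> embed_exp ` Poly_Mapping.keys p"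
  unfolding embed_coeff_def by (intro order.trans[OF keys_sum]) (auto split: if_splits)

lemma embed_coeff_eq_0_iff [simp]: "embed_coeff p = 0 \<longleftrightarrow> p = 0"
proof
  assume "embed_coeff p = 0"
  then show "p = 0"
    by (intro poly_mapping_eqI) (metis lookup_embed_coeff lookup_zero)
qed (simp add: embed_coeff.hom_zero)

lemma embed_coeff_eq_iff [simp]: "embed_coeff p = embed_coeff q \<longleftrightarrow> p = q"
  using embed_coeff_eq_0_iff[of "p - q"] by (simp only: embed_coeff.hom_diff right_minus_eq)

definition monom_coeff :: "('n::finite \<Rightarrow> nat) \<Rightarrow> 'n cpoly"
  where "monom_coeff m = (\<Prod>i\<in>UNIV. cvar i ^ m i)"

lemma embed_cconst: "embed_coeff (cconst c) = Poly_Mapping.single 0 c"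
  by (simp add: cconst_def embed_coeff_single)

lemma embed_cvar: "embed_coeff (cvar i) = Poly_Mapping.single (Poly_Mapping.single (xidx i) 1) 1"
  by (simp add: cvar_def embed_coeff_single embed_exp_single)

lemma single_power:
  "Poly_Mapping.single (Poly_Mapping.single k a) (1::'b::comm_semiring_1) ^ n =
    Poly_Mapping.single (Poly_Mapping.single k (int n * a)) 1"
  by (induction n) (simp_all add: mult_single algebra_simps flip: single_add)

lemma single_prod:
  "(\<Prod>i\<in>A. Poly_Mapping.single (f i) (1::'b::comm_semiring_1)) = Poly_Mapping.single (\<Sum>i\<in>A. f i) 1"
  by (induction A rule: infinite_finite_induct) (simp_all add: mult_single)

lemma embed_monom_coeff:
  "embed_coeff (monom_coeff m) = Poly_Mapping.single (xexp (\<lambda>i. int (m i))) 1"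
  by (simp add: monom_coeff_def embed_coeff.hom_prod embed_coeff.hom_power embed_cvar single_power
      single_prod xexp_def)

definition laurent_y :: laurent
  where "laurent_y = Poly_Mapping.single (Poly_Mapping.single 0 1) 1"

abbreviation embed_xy :: "'n::finite cpoly poly \<Rightarrow> laurent"
  where "embed_xy \<equiv> embed_coeff.eval laurent_y"

interpretation embed_xy: algebra_hom embed_xy
  by (rule embed_coeff.algebra_hom_eval)

definition laurent_z :: "('n::finite \<Rightarrow> nat) \<Rightarrow> 'n cpoly poly \<Rightarrow> laurent"
  where "laurent_z m Q = Poly_Mapping.single (xexp (\<lambda>i. - int (m i))) 1 * embed_xy Q"

abbreviation embed :: "('n::finite \<Rightarrow> nat) \<Rightarrow> 'n cpoly poly \<Rightarrow> 'n cpoly poly poly \<Rightarrow> laurent"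
  where "embed m Q \<equiv> embed_xy.eval (laurent_z m Q)"

interpretation embed: algebra_hom "embed m Q" for m Q
  by (rule embed_xy.algebra_hom_eval)

lemma danielewski_eq_alt: "danielewski_eq m Q = [:- Q, [:monom_coeff m:]:]"
  by (simp add: danielewski_eq_def monom_coeff_def)

lemma embed_danielewski_eq [simp]: "embed m Q (danielewski_eq m Q) = 0"
proof -
  have "embed_coeff (monom_coeff m) * Poly_Mapping.single (xexp (\<lambda>i. - int (m i))) 1 = 1"
    by (simp add: embed_monom_coeff mult_single flip: xexp_add)
  then show ?thesis
    by (simp add: danielewski_eq_alt laurent_z_def embed_xy.hom_uminus algebra_simps)
qed

section \<open>Normal forms and their leading terms\<close>

text \<open>As \<open>Q\<close> is monic in \<open>y\<close>, the equation rewrites it to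
  \<open>x^m z\<close>. With \<open>r\<close> the degree of \<open>Q\<close>, these are the
  polynomials in which every coefficient of a power of \<open>z\<close> is already reduced modulo
  \<open>Q\<close>.\<close>

definition normal_form :: "nat \<Rightarrow> 'a::zero poly poly \<Rightarrow> bool"
  where "normal_form r p \<longleftrightarrow> (\<forall>k. Polynomial.degree (coeff p k) < r)"

lemma normal_form_add: "normal_form r p \<Longrightarrow> normal_form r q \<Longrightarrow> normal_form r (p + q)"
  by (simp add: normal_form_def degree_add_less)

lemma normal_form_pCons: "normal_form r (pCons a p) \<longleftrightarrow> Polynomial.degree a < r \<and> normal_form r p"
  by (auto simp: normal_form_def coeff_pCons split: nat.splits)

lemma normal_form_smult: "normal_form r p \<Longrightarrow> normal_form r (Polynomial.smult [:c:] p)" for p :: "'a::comm_semiring_0 poly poly"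
  by (auto simp: normal_form_def intro: le_less_trans[OF degree_smult_le])

lemma degree_diff_lead_less:
  fixes p q :: "'a::ab_group_add poly"
  assumes "Polynomial.degree q \<le> Polynomial.degree p" "coeff q (Polynomial.degree p) = lead_coeff p"
    and "0 < Polynomial.degree p"
  shows "Polynomial.degree (p - q) < Polynomial.degree p"
proof -
  have "Polynomial.degree (p - q) \<le> Polynomial.degree p - 1"
  proof (rule degree_le, intro allI impI)
    fix i
    assume "Polynomial.degree p - 1 < i"
    then consider "i = Polynomial.degree p" | "Polynomial.degree p < i" by linarith
    then show "coeff (p - q) i = 0"
      using assms(1,2) by cases (simp_all add: coeff_eq_0)
  qed
  with assms(3) show ?thesis by linarith
qed

text \<open>Division by the monic \<open>Q\<close>: the leading term of \<open>q\<close> is split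
  off as a multiple \<open>q1 * Q\<close>, which is congruent to \<open>x^m z q1\<close>. Both
  \<open>q1\<close> and \<open>q - q1 * Q\<close> have smaller degree than \<open>q\<close>.\<close>

lemma normal_form_const_exists:
  fixes Q q :: "'n::finite cpoly poly"
  assumes lc: "lead_coeff Q = 1" and r: "0 < Polynomial.degree Q"
  shows "\<exists>p'. normal_form (Polynomial.degree Q) p' \<and> danielewski_eq m Q dvd [:q:] - p'"
proof (induction "Polynomial.degree q" arbitrary: q rule: less_induct)
  case less
  show ?case
  proof (cases "Polynomial.degree q < Polynomial.degree Q")
    case True
    with r show ?thesis
      by (intro exI[of _ "[:q:]"]) (simp add: normal_form_pCons, simp add: normal_form_def)
  next
    case False
    define q1 where "q1 = Polynomial.monom (lead_coeff q) (Polynomial.degree q - Polynomial.degree Q)"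
    have "Polynomial.degree q1 < Polynomial.degree q"
      using False r by (auto simp: q1_def intro: le_less_trans[OF degree_monom_le])
    then obtain p1 where p1: "normal_form (Polynomial.degree Q) p1" "danielewski_eq m Q dvd [:q1:] - p1"
      using less by blast
    have "Polynomial.degree (q1 * Q) \<le> Polynomial.degree q"
      using False degree_monom_le[of "lead_coeff q" "Polynomial.degree q - Polynomial.degree Q"]
      by (intro order.trans[OF degree_mult_le]) (simp add: q1_def)
    moreover have "coeff (q1 * Q) (Polynomial.degree q) = lead_coeff q"
      using False by (simp add: q1_def coeff_monom_mult lc)
    ultimately have "Polynomial.degree (q - q1 * Q) < Polynomial.degree q"
      using False r by (intro degree_diff_lead_less) auto
    then obtain p2 where p2: "normal_form (Polynomial.degree Q) p2"
        "danielewski_eq m Q dvd [:q - q1 * Q:] - p2"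
      using less by blast
    \<comment> \<open>Multiplying the normal form of \<open>q1\<close> by \<open>x^m z\<close> keeps
      it normal: \<open>z\<close> only shifts coefficients and \<open>x^m\<close> is free of
      \<open>y\<close>.\<close>
    define p' where "p' = pCons 0 (Polynomial.smult [:monom_coeff m:] p1) + p2"
    have "[:q:] - p' = [:0, [:monom_coeff m:]:] * ([:q1:] - p1) + ([:q - q1 * Q:] - p2)
        - [:q1:] * danielewski_eq m Q"
      by (simp add: p'_def danielewski_eq_alt smult_diff_right algebra_simps)
    then have "danielewski_eq m Q dvd [:q:] - p'"
      using p1(2) p2(2) by (metis dvd_add dvd_diff dvd_mult dvd_triv_right)
    moreover have "normal_form (Polynomial.degree Q) p'"
      using p1(1) p2(1) r by (simp add: p'_def normal_form_add normal_form_pCons normal_form_smult)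
    ultimately show ?thesis by blast
  qed
qed

lemma normal_form_exists:
  fixes Q :: "'n::finite cpoly poly"
  assumes "lead_coeff Q = 1" "0 < Polynomial.degree Q"
  shows "\<exists>p'. normal_form (Polynomial.degree Q) p' \<and> danielewski_eq m Q dvd p - p'"
proof (induction p)
  case 0
  show ?case
    using assms by (intro exI[of _ 0]) (simp add: normal_form_def)
next
  case (pCons a p)
  then obtain p0 where p0: "normal_form (Polynomial.degree Q) p0" "danielewski_eq m Q dvd p - p0"
    by blast
  obtain q0 where q0: "normal_form (Polynomial.degree Q) q0" "danielewski_eq m Q dvd [:a:] - q0"
    using normal_form_const_exists[OF assms] by blast
  have "pCons a p - (q0 + pCons 0 p0) = ([:a:] - q0) + [:0, 1:] * (p - p0)"
    by simp
  then have "danielewski_eq m Q dvd pCons a p - (q0 + pCons 0 p0)"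
    using p0(2) q0(2) by (metis dvd_add dvd_mult)
  with p0 q0 assms(2) show ?case
    by (intro exI[of _ "q0 + pCons 0 p0"]) (simp add: normal_form_add normal_form_pCons)
qed

section \<open>Leading forms with respect to the y-degree\<close>

text \<open>Here \<open>a\<close> is the homogeneous part of \<open>b\<close> of y-degree
  \<open>N\<close>, and nothing of higher degree occurs. The part \<open>a\<close> may be zero, in
  which case \<open>N\<close> is merely a strict upper bound.\<close>

definition topform :: "int \<Rightarrow> laurent \<Rightarrow> laurent \<Rightarrow> bool"
  where "topform N b a \<longleftrightarrow> (\<forall>u\<in>Poly_Mapping.keys a. Poly_Mapping.lookup u 0 = N) \<and>
    (\<forall>u\<in>Poly_Mapping.keys (b - a). Poly_Mapping.lookup u 0 < N)"

lemma topform_keys_le: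
  assumes "topform N b a" "u \<in> Poly_Mapping.keys b"
  shows "Poly_Mapping.lookup u 0 \<le> N"
proof -
  have "b = a + (b - a)" by simp
  with assms(2) have "u \<in> Poly_Mapping.keys a \<union> Poly_Mapping.keys (b - a)"
    using keys_add by (metis subsetD)
  with assms(1) show ?thesis by (auto simp: topform_def)
qed

lemma topform_lower:
  assumes "topform N b a" "N < M"
  shows "topform M b 0"
  using topform_keys_le[OF assms(1)] assms(2) by (fastforce simp: topform_def)

lemma topform_add:
  assumes "topform N b a" "topform N b' a'"
  shows "topform N (b + b') (a + a')"
proof -
  have "(b + b') - (a + a') = (b - a) + (b' - a')" by simp
  then have "Poly_Mapping.keys ((b + b') - (a + a')) \<subseteq>
      Poly_Mapping.keys (b - a) \<union> Poly_Mapping.keys (b' - a')"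
    using keys_add by metis
  moreover have "Poly_Mapping.keys (a + a') \<subseteq> Poly_Mapping.keys a \<union> Poly_Mapping.keys a'"
    by (rule keys_add)
  ultimately show ?thesis
    using assms unfolding topform_def by blast
qed

lemma topform_mult:
  assumes "topform N b a" "topform M b' a'"
  shows "topform (N + M) (b * b') (a * a')"
proof -
  have "b * b' - a * a' = (b - a) * b' + a * (b' - a')"
    by (simp add: algebra_simps)
  then have "Poly_Mapping.keys (b * b' - a * a') \<subseteq>
      Poly_Mapping.keys ((b - a) * b') \<union> Poly_Mapping.keys (a * (b' - a'))"
    using keys_add by metis
  moreover have "Poly_Mapping.lookup u 0 < N + M" if "u \<in> Poly_Mapping.keys ((b - a) * b')" for u
    using that keys_mult[of "b - a" b'] topform_keys_le[OF assms(2)] assms(1)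
    by (fastforce simp: topform_def lookup_add)
  moreover have "Poly_Mapping.lookup u 0 < N + M" if "u \<in> Poly_Mapping.keys (a * (b' - a'))" for u
    using that keys_mult[of a "b' - a'"] assms by (fastforce simp: topform_def lookup_add)
  moreover have "Poly_Mapping.lookup u 0 = N + M" if "u \<in> Poly_Mapping.keys (a * a')" for u
    using that keys_mult[of a a'] assms by (fastforce simp: topform_def lookup_add)
  ultimately show ?thesis
    unfolding topform_def by blast
qed

lemma topform_refl_iff: "topform N a a \<longleftrightarrow> (\<forall>u\<in>Poly_Mapping.keys a. Poly_Mapping.lookup u 0 = N)"
  by (simp add: topform_def)

lemma topform_zero [simp]: "topform N 0 0"
  by (simp add: topform_def)

lemma topform_embed_coeff: "topform 0 (embed_coeff c) (embed_coeff c)"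
  using keys_embed_coeff_subset[of c] by (auto simp: topform_refl_iff)

lemma topform_embed_xy:
  "topform (int (Polynomial.degree q)) (embed_xy q)
    (Poly_Mapping.single (Poly_Mapping.single 0 (int (Polynomial.degree q))) 1 *
      embed_coeff (lead_coeff q))"
proof (induction q)
  case (pCons a q)
  have y: "topform 1 laurent_y laurent_y"
    by (simp add: topform_refl_iff laurent_y_def del: single_one)
  show ?case
  proof (cases "q = 0")
    case True
    then show ?thesis by (simp add: topform_embed_coeff)
  next
    case False
    have "topform (1 + int (Polynomial.degree q)) (embed_coeff a + laurent_y * embed_xy q)
      (0 + laurent_y * (Poly_Mapping.single (Poly_Mapping.single 0 (int (Polynomial.degree q))) 1 *
        embed_coeff (lead_coeff q)))"
      by (intro topform_add topform_lower[OF topform_embed_coeff] topform_mult[OF y pCons.IH]) simp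
    moreover have "laurent_y * Poly_Mapping.single (Poly_Mapping.single 0 (int (Polynomial.degree q))) 1 =
        Poly_Mapping.single (Poly_Mapping.single 0 (1 + int (Polynomial.degree q))) 1"
      by (simp add: laurent_y_def mult_single single_add del: single_one)
    ultimately show ?thesis
      using False by (simp flip: mult.assoc)
  qed
qed (simp add: embed_coeff.hom_zero)

text \<open>The leading exponent of \<open>y^l z^k\<close>: each factor \<open>z = x^(-m) Q\<close>
  contributes \<open>x^(-m) y^r\<close>.\<close>

definition lead_exp :: "('n::finite \<Rightarrow> nat) \<Rightarrow> nat \<Rightarrow> nat \<Rightarrow> nat \<Rightarrow> nat \<Rightarrow>\<^sub>0 int"
  where "lead_exp m r l k =
    Poly_Mapping.single 0 (int (r * k + l)) + xexp (\<lambda>i. - int (k * m i))"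

lemma lookup_lead_exp [simp]:
  "Poly_Mapping.lookup (lead_exp m r l k) 0 = int (r * k + l)"
  "Poly_Mapping.lookup (lead_exp m r l k) (xidx i) = - int (k * m i)"
  by (simp_all add: lead_exp_def lookup_add lookup_single when_def)

lemma lead_exp_Suc:
  "lead_exp m r l (Suc k) = lead_exp m r 0 1 + lead_exp m r l k"
proof -
  have "xexp (\<lambda>i. - int (Suc k * m i)) = xexp (\<lambda>i. - int (m i)) + xexp (\<lambda>i. - int (k * m i))"
    by (simp flip: xexp_add add: algebra_simps)
  then show ?thesis
    by (simp add: lead_exp_def single_add algebra_simps del: single_of_nat)
qed

lemma topform_laurent_z:
  assumes "lead_coeff Q = 1"
  shows "topform (int (Polynomial.degree Q)) (laurent_z m Q)
    (Poly_Mapping.single (lead_exp m (Polynomial.degree Q) 0 1) 1)"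
proof -
  have "topform (0 + int (Polynomial.degree Q)) (laurent_z m Q)
    (Poly_Mapping.single (xexp (\<lambda>i. - int (m i))) 1 *
      (Poly_Mapping.single (Poly_Mapping.single 0 (int (Polynomial.degree Q))) 1 *
      embed_coeff (lead_coeff Q)))"
    unfolding laurent_z_def
    by (intro topform_mult topform_embed_xy) (simp add: topform_refl_iff)
  then show ?thesis
    by (simp add: assms mult_single embed_coeff.hom_one lead_exp_def add.commute del: single_of_nat)
qed

abbreviation ydeg :: "nat \<Rightarrow> 'a::zero poly poly \<Rightarrow> nat"
  where "ydeg r p \<equiv> r * Polynomial.degree p + Polynomial.degree (lead_coeff p)"

text \<open>No cancellation can occur at the top: in \<open>a + z p\<close> with \<open>p\<close>
  non-zero the second summand has y-degree at least \<open>r\<close>, while \<open>a\<close> has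
  y-degree below \<open>r\<close>.\<close>

lemma topform_embed:
  assumes Q: "lead_coeff Q = 1" "Polynomial.degree Q = r" and p: "normal_form r p"
  shows "topform (int (ydeg r p)) (embed m Q p)
    (Poly_Mapping.single (lead_exp m r (Polynomial.degree (lead_coeff p)) (Polynomial.degree p)) 1 *
      embed_coeff (lead_coeff (lead_coeff p)))"
  using p
proof (induction p)
  case (pCons a p)
  then have a: "Polynomial.degree a < r" and p: "normal_form r p"
    by (simp_all add: normal_form_pCons)
  show ?case
  proof (cases "p = 0")
    case True
    then show ?thesis
      using topform_embed_xy[of a] by (simp add: lead_exp_def del: single_of_nat)
  next
    case False
    define b where "b = Poly_Mapping.single (lead_exp m r 0 1) 1 *
        (Poly_Mapping.single (lead_exp m r (Polynomial.degree (lead_coeff p)) (Polynomial.degree p)) 1 *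
        embed_coeff (lead_coeff (lead_coeff p)))"
    have top: "topform (int r + int (ydeg r p)) (embed_xy a + laurent_z m Q * embed m Q p) (0 + b)"
      unfolding b_def using topform_laurent_z[OF Q(1), of m] unfolding Q(2)
      by (intro topform_add topform_lower[OF topform_embed_xy] topform_mult pCons.IH p)
        (use a in \<open>simp_all add: trans_less_add1 flip: of_nat_add of_nat_mult\<close>)
    have deg: "int r + int (ydeg r p) = int (ydeg r (pCons a p))"
      using False by (simp add: algebra_simps)
    have "b = Poly_Mapping.single (lead_exp m r 0 1 +
        lead_exp m r (Polynomial.degree (lead_coeff p)) (Polynomial.degree p)) 1 *
        embed_coeff (lead_coeff (lead_coeff p))"
      unfolding b_def mult.assoc[symmetric] mult_single by (simp only: mult_1)
    then have lead: "0 + b = Poly_Mapping.single (lead_exp m r (Polynomial.degree (lead_coeff (pCons a p)))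
        (Polynomial.degree (pCons a p))) 1 * embed_coeff (lead_coeff (lead_coeff (pCons a p)))"
      using False by (simp add: lead_exp_Suc[of m r "Polynomial.degree (lead_coeff p)" "Polynomial.degree p"])
    show ?thesis
      using top unfolding deg lead embed_xy.eval_pCons .
  qed
qed (simp add: embed_coeff.hom_zero)

lemma single_one_neq_0 [simp]: "Poly_Mapping.single u (1::'a::zero_neq_one) \<noteq> 0"
  by (metis lookup_single_eq lookup_zero one_neq_zero)

lemma embed_normal_eq_0:
  assumes Q: "lead_coeff Q = 1" "Polynomial.degree Q = r" and p: "normal_form r p"
    and 0: "embed m Q p = 0"
  shows "p = 0"
proof -
  define a where "a = Poly_Mapping.single
      (lead_exp m r (Polynomial.degree (lead_coeff p)) (Polynomial.degree p)) 1 *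
      embed_coeff (lead_coeff (lead_coeff p))"
  have "topform (int (ydeg r p)) 0 a"
    using topform_embed[OF Q p, of m] by (simp add: 0 a_def)
  \<comment> \<open>An exponent of \<open>a\<close> would have y-degree both equal to and smaller
    than the bound.\<close>
  then have "Poly_Mapping.keys a = {}"
    unfolding topform_def diff_0 keys_minus by force
  then have "a = 0" by simp
  then show ?thesis by (simp add: a_def)
qed

text \<open>The embedding kills the equation and is injective on normal forms, so its kernel is the
  ideal of the variety.\<close>

lemma embed_eq_0_iff:
  assumes Q: "lead_coeff Q = 1" "0 < Polynomial.degree Q"
  shows "embed m Q p = 0 \<longleftrightarrow> danielewski_eq m Q dvd p"
proof
  assume 0: "embed m Q p = 0"
  obtain p' where p': "normal_form (Polynomial.degree Q) p'" "danielewski_eq m Q dvd p - p'"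
    using normal_form_exists[OF Q] by blast
  then have "embed m Q (p - p') = 0"
    by (auto simp: embed.hom_mult elim!: dvdE)
  with 0 have "embed m Q p' = 0"
    by (simp add: embed.hom_diff)
  then have "p' = 0"
    using embed_normal_eq_0[OF Q(1) refl p'(1)] by blast
  with p'(2) show "danielewski_eq m Q dvd p" by simp
qed (auto simp: embed.hom_mult elim!: dvdE)

lemma poly_mapping_le_lookup_0:
  fixes u v :: "nat \<Rightarrow>\<^sub>0 int"
  assumes "u \<le> v"
  shows "Poly_Mapping.lookup u 0 \<le> Poly_Mapping.lookup v 0"
  using assms unfolding less_eq_poly_mapping.rep_eq less_fun_def
  by (metis le_less not_gr_zero order_refl)

text \<open>The leading exponent comes from the leading form of a normal form, hence is
  \<open>lead_exp m r l k\<close> plus the exponent of a monomial in the \<open>x_i\<close>, whose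
  entries are non-negative.\<close>

lemma embed_lead_exp:
  fixes m :: "'n::finite \<Rightarrow> nat"
  assumes Q: "lead_coeff Q = 1" "Polynomial.degree Q = r" "0 < r"
    and u: "Poly_Mapping.keys (embed m Q p) \<subseteq> {..u}" "u \<in> Poly_Mapping.keys (embed m Q p)"
  shows "0 \<le> Poly_Mapping.lookup u 0"
    and "- (Poly_Mapping.lookup u 0 div int r * int (m i)) \<le> Poly_Mapping.lookup u (xidx i)"
proof -
  obtain p' where p': "normal_form r p'" "danielewski_eq m Q dvd p - p'"
    using normal_form_exists[OF Q(1)] Q(2,3) by blast
  then have "embed m Q (p - p') = 0"
    by (auto simp: embed.hom_mult elim!: dvdE)
  then have eq: "embed m Q p = embed m Q p'"
    by (simp add: embed.hom_diff)
  define k l c where "k = Polynomial.degree p'" and "l = Polynomial.degree (lead_coeff p')"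
    and "c = lead_coeff (lead_coeff p')"
  define a where "a = Poly_Mapping.single (lead_exp m r l k) 1 * embed_coeff c"
  have top: "topform (int (r * k + l)) (embed m Q p) a"
    using topform_embed[OF Q(1,2) p'(1), of m] unfolding eq a_def k_def l_def c_def .
  have "p' \<noteq> 0"
    using u(2) eq by auto
  then have "a \<noteq> 0"
    by (simp add: a_def c_def)
  then obtain v where v: "v \<in> Poly_Mapping.keys a" by fastforce
  \<comment> \<open>Exponents of the leading form cannot cancel against the rest. Hence the maximal
    \<open>u\<close> has the full y-degree and itself lies in the leading form.\<close>
  have lower: "w \<notin> Poly_Mapping.keys (embed m Q p - a)" if "Poly_Mapping.lookup w 0 = int (r * k + l)" for w
    using that top by (auto simp: topform_def)
  have v0: "Poly_Mapping.lookup v 0 = int (r * k + l)"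
    using v top by (simp add: topform_def)
  then have "v \<in> Poly_Mapping.keys (embed m Q p)"
    using lower[of v] v by (simp add: in_keys_iff lookup_minus)
  then have "int (r * k + l) \<le> Poly_Mapping.lookup u 0"
    using u(1) v0 poly_mapping_le_lookup_0[of v u] by auto
  with topform_keys_le[OF top u(2)] have u0: "Poly_Mapping.lookup u 0 = int (r * k + l)"
    by simp
  then have "u \<in> Poly_Mapping.keys a"
    using lower[of u] u(2) by (simp add: in_keys_iff lookup_minus)
  then obtain v' where v': "u = lead_exp m r l k + v'" "v' \<in> Poly_Mapping.keys (embed_coeff c)"
    using keys_mult[of "Poly_Mapping.single (lead_exp m r l k) 1" "embed_coeff c"]
    by (auto simp: a_def)
  then obtain e :: "'n \<Rightarrow>\<^sub>0 nat" where e: "u = lead_exp m r l k + embed_exp e"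
    using keys_embed_coeff_subset[of c] by blast
  have "l < r"
    using p'(1) by (simp add: normal_form_def l_def)
  \<comment> \<open>The bound \<open>l < r\<close> from normality lets the y-degree
    \<open>r * k + l\<close> determine \<open>k\<close>.\<close>
  then have "Poly_Mapping.lookup u 0 div int r = int k"
    unfolding u0 by (simp flip: zdiv_int)
  then show "- (Poly_Mapping.lookup u 0 div int r * int (m i)) \<le> Poly_Mapping.lookup u (xidx i)"
    by (simp add: e lookup_add)
  show "0 \<le> Poly_Mapping.lookup u 0"
    by (simp add: u0)
qed

section \<open>Locally nilpotent derivations\<close>

text \<open>
  Here \<open>(s, w)\<close> is the degree of the leading part of a locally nilpotent derivation, and \<open>\<mu>\<close>, \<open>\<nu>\<close>,
  \<open>\<zeta>\<close> are the nilpotency orders of \<open>y\<close>, \<open>x\<^sub>i\<close>, \<open>z\<close> with respect to it.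
\<close>

lemma demazure_root_unique:
  fixes w \<nu> m :: "'n::finite \<Rightarrow> int" and s \<mu> \<zeta> r :: int
  assumes r: "2 \<le> r" and m: "\<And>i. 2 \<le> m i"
    and nonneg: "\<And>i. 0 \<le> \<nu> i" "0 \<le> \<mu>" "0 \<le> \<zeta>"
    and \<zeta>: "\<zeta> = r * \<mu> - (\<Sum>i\<in>UNIV. m i * \<nu> i)"
    and w: "s * \<mu> + (\<Sum>i\<in>UNIV. w i * \<nu> i) = - 1"
    and x: "\<And>i. \<nu> i \<noteq> 0 \<Longrightarrow> 0 \<le> s"
      "\<And>i. \<nu> i \<noteq> 0 \<Longrightarrow> - (s div r * m i) \<le> w i + 1"
      "\<And>i j. \<nu> i \<noteq> 0 \<Longrightarrow> j \<noteq> i \<Longrightarrow> - (s div r * m j) \<le> w j"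
    and y: "\<And>j. \<mu> \<noteq> 0 \<Longrightarrow> - ((s + 1) div r * m j) \<le> w j"
  shows "s = - 1"
proof (cases "\<forall>i. \<nu> i = 0")
  case True
  with w have "s * \<mu> = - 1" by simp
  with nonneg(2) show ?thesis
    by (metis zmult_eq_neg1_iff neg_0_le_iff_le not_one_le_zero)
next
  case False
  then obtain i where i: "\<nu> i \<noteq> 0" by blast
  define q where "q = s div r"
  define S where "S = (\<Sum>i\<in>UNIV. m i * \<nu> i)"
  have li: "1 \<le> \<nu> i"
    using i nonneg(1)[of i] by linarith
  have s: "0 \<le> s" by (rule x(1)[OF i])
  then have q: "0 \<le> q" using r by (simp add: q_def pos_imp_zdiv_nonneg_iff)
  have srq: "s = q * r + s mod r" by (simp add: q_def)
  have S: "S \<le> r * \<mu>" using \<zeta> nonneg(3) by (simp add: S_def)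
  have "m i * \<nu> i \<le> S"
    unfolding S_def
    by (rule member_le_sum) (use m nonneg(1) in \<open>auto intro!: mult_nonneg_nonneg order.trans[OF _ m]\<close>)
  moreover have "2 * \<nu> i \<le> m i * \<nu> i"
    using m[of i] li by (intro mult_right_mono) auto
  ultimately have rm: "2 * \<nu> i \<le> r * \<mu>" using S by linarith
  with li have \<mu>: "\<mu> \<noteq> 0" by auto
  have qS: "q * S \<le> q * (r * \<mu>)"
    using S q by (rule mult_left_mono)
  have smu: "s * \<mu> = q * (r * \<mu>) + (s mod r) * \<mu>"
    by (subst srq) (simp add: algebra_simps)
  have mod_nonneg: "0 \<le> (s mod r) * \<mu>"
    using r nonneg(2) by simp
  show ?thesis
  \<comment> \<open>Both cases are contradictory. If the quotient is unchanged, the constraint from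
    \<open>y\<close> gives \<open>w j \<ge> - q * m j\<close> for every \<open>j\<close>, and the
    left side of the equation for \<open>w\<close> is at least
    \<open>(s mod r) * \<mu> \<ge> 0\<close>, not \<open>-1\<close>.\<close>
  proof (cases "(s + 1) div r = q")
    case True
    have "- (q * S) = (\<Sum>j\<in>UNIV. - (q * m j) * \<nu> j)"
      by (simp add: S_def sum_distrib_left sum_negf algebra_simps)
    also have "\<dots> \<le> (\<Sum>j\<in>UNIV. w j * \<nu> j)"
      using y[OF \<mu>] nonneg(1) unfolding True by (intro sum_mono mult_right_mono) auto
    finally show ?thesis
      using w qS smu mod_nonneg by linarith
  next
    case False
    \<comment> \<open>The quotient changes only at the last residue. The weaker constraint from
      \<open>x_i\<close> then costs at most \<open>\<nu> i\<close>, which the large remainder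
      outweighs.\<close>
    have "s mod r = r - 1"
    proof (rule ccontr)
      assume "s mod r \<noteq> r - 1"
      then have "s mod r + 1 < r" using pos_mod_bound[of r s] r by linarith
      moreover have "(s + 1) div r = q + (s mod r + 1) div r"
        using r by (subst srq) (simp add: add.assoc)
      ultimately have "(s + 1) div r = q"
        using r pos_mod_sign[of r s] by (simp add: div_pos_pos_trivial)
      with False show False by simp
    qed
    then have modmu: "(s mod r) * \<mu> = r * \<mu> - \<mu>"
      by (simp only: left_diff_distrib mult_1)
    have "- (q * S) - \<nu> i = (\<Sum>j\<in>UNIV. (if j = i then - \<nu> i else 0) - (q * m j) * \<nu> j)"
      by (simp add: S_def sum_distrib_left sum_subtractf algebra_simps)
    also have "\<dots> \<le> (\<Sum>j\<in>UNIV. w j * \<nu> j)"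
    proof (rule sum_mono)
      fix j
      show "(if j = i then - \<nu> i else 0) - (q * m j) * \<nu> j \<le> w j * \<nu> j"
      proof (cases "j = i")
        case True
        then show ?thesis
          using mult_right_mono[OF x(2)[OF i] nonneg(1)[of i]] by (simp add: q_def algebra_simps)
      next
        case False
        then show ?thesis
          using mult_right_mono[OF x(3)[OF i False] nonneg(1)[of j]] by (simp add: q_def)
      qed
    qed
    \<comment> \<open>This contradicts
      \<open>2 * \<nu> i \<le> r * \<mu> \<le> 2 * (r - 1) * \<mu>\<close>, where the first
      inequality rests on \<open>m i \<ge> 2\<close> and the second on
      \<open>r \<ge> 2\<close>.\<close>
    finally have "1 + (r * \<mu> - \<mu>) \<le> \<nu> i"
      using w qS smu modmu by linarith
    moreover have "2 * \<mu> \<le> r * \<mu>"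
      using r nonneg(2) by (rule mult_right_mono)
    ultimately show ?thesis using rm by linarith
  qed
qed

section \<open>The leading part of a locally nilpotent derivation\<close>

abbreviation coords :: "'n::finite itself \<Rightarrow> nat set"
  where "coords TYPE('n) \<equiv> insert 0 (range (xidx :: 'n \<Rightarrow> nat))"

lemma sum_coords:
  fixes g :: "nat \<Rightarrow> 'b::comm_monoid_add"
  shows "(\<Sum>k\<in>coords TYPE('n::finite). g k) = g 0 + (\<Sum>i::'n\<in>UNIV. g (xidx i))"
proof -
  have "inj (xidx :: 'n \<Rightarrow> nat)" by (simp add: inj_on_def)
  then show ?thesis by (subst sum.insert) (auto simp: sum.reindex)
qed

lemma symbol_coords:
  "symbol (coords TYPE('n::finite)) f w u = of_int (Poly_Mapping.lookup u 0) * Poly_Mapping.lookup (f 0) w +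
    (\<Sum>i::'n\<in>UNIV. of_int (Poly_Mapping.lookup u (xidx i)) * Poly_Mapping.lookup (f (xidx i)) w)"
  by (simp add: symbol_def sum_coords)

lemma vfield_monomial:
  assumes "finite K" "k \<in> K"
  shows "vfield K f (Poly_Mapping.single (Poly_Mapping.single k 1) c) =
    f k * Poly_Mapping.single (Poly_Mapping.single k 1) c"
proof -
  have "vfield K f (Poly_Mapping.single (Poly_Mapping.single k 1) c) =
      (\<Sum>j\<in>K. if j = k then f k * Poly_Mapping.single (Poly_Mapping.single k 1) c else 0)"
    unfolding vfield_def by (intro sum.cong refl) (auto simp: euler_single lookup_single when_def)
  then show ?thesis using assms by simp
qed

lemma poly_mapping_less_lookup_0:
  fixes u v :: "nat \<Rightarrow>\<^sub>0 int"
  assumes "Poly_Mapping.lookup u 0 < Poly_Mapping.lookup v 0"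
  shows "u < v"
  using assms unfolding less_poly_mapping.rep_eq less_fun_def by auto

text \<open>Passes from the y-degree to the lexicographic order: if the leading form is one
  monomial, its exponent dominates all others.\<close>

lemma topform_monomial:
  assumes "topform N b (Poly_Mapping.single u 1)"
  shows "Poly_Mapping.keys b \<subseteq> {..u}" "Poly_Mapping.lookup b u = 1"
proof -
  have u: "Poly_Mapping.lookup u 0 = N"
    using assms by (simp add: topform_def)
  have lower: "v < u" if "v \<in> Poly_Mapping.keys (b - Poly_Mapping.single u 1)" for v
    using assms that u by (intro poly_mapping_less_lookup_0) (simp add: topform_def)
  show "Poly_Mapping.lookup b u = 1"
    using lower[of u] by (auto simp: in_keys_iff lookup_minus)
  show "Poly_Mapping.keys b \<subseteq> {..u}"
  proof
    fix v
    assume "v \<in> Poly_Mapping.keys b"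
    then show "v \<in> {..u}"
      using lower[of v] by (cases "v = u") (auto simp: in_keys_iff lookup_minus lookup_single)
  qed
qed

lemma embed_cvar_const:
  "embed m Q [:[:cvar i:]:] = Poly_Mapping.single (Poly_Mapping.single (xidx i) 1) 1"
  by (simp add: embed_cvar)

lemma embed_y: "embed m Q [:[:0, 1:]:] = laurent_y"
  by (simp add: embed_coeff.hom_zero embed_coeff.hom_one)

lemma embed_z: "embed m Q [:0, 1:] = laurent_z m Q"
  by (simp add: embed_xy.hom_zero embed_xy.hom_one)

text \<open>If some x-component were non-zero, the nilpotency orders of \<open>x_j\<close>,
  \<open>y\<close> and \<open>z\<close> along the leading part would satisfy the hypotheses of
  \<open>demazure_root_unique\<close>. The leading part then has y-degree \<open>-1\<close>, which
  is too low for a non-zero value on \<open>x_i\<close>.\<close>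

theorem vfield_locally_nilpotent_x:
  fixes m :: "'n::finite \<Rightarrow> nat" and Q :: "'n cpoly poly" and f :: "nat \<Rightarrow> laurent"
  defines "K \<equiv> coords TYPE('n)"
  assumes m: "\<And>i. m i > 1" and Q: "lead_coeff Q = 1" "Polynomial.degree Q = r" "2 \<le> r"
    and stable: "\<And>p. vfield K f (embed m Q p) \<in> range (embed m Q)"
    and nil: "\<And>p. \<exists>n. (vfield K f ^^ n) (embed m Q p) = 0"
  shows "f (xidx (i :: 'n)) = 0"
proof (rule ccontr)
  assume fi: "f (xidx i) \<noteq> 0"
  let ?e = "\<lambda>k::nat. Poly_Mapping.single k (1::int)"
  have finK: "finite K" by (simp add: K_def)
  have xK: "xidx (j :: 'n) \<in> K" for j by (simp add: K_def)
  define W where "W = (\<Union>k\<in>K. Poly_Mapping.keys (f k))"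
  have finW: "finite W" by (simp add: W_def finK)
  have "W \<noteq> {}" using fi xK[of i] by (auto simp: W_def)
  define w where "w = Max W"
  have "w \<in> W" unfolding w_def by (rule Max_in) fact+
  have le: "Poly_Mapping.keys (f k) \<subseteq> {..w}" if "k \<in> K" for k
    using that finW by (auto simp: w_def W_def intro!: Max_ge)
  define \<alpha> where "\<alpha> j = Poly_Mapping.lookup (f (xidx j)) w" for j :: 'n
  define \<beta> where "\<beta> = Poly_Mapping.lookup (f 0) w"
  define \<sigma> where "\<sigma> = symbol K f w"
  have \<sigma>: "\<sigma> u = of_int (Poly_Mapping.lookup u 0) * \<beta> +
      (\<Sum>j\<in>UNIV. of_int (Poly_Mapping.lookup u (xidx j)) * \<alpha> j)" for u
    by (simp add: \<sigma>_def K_def symbol_coords \<alpha>_def \<beta>_def)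
  have \<sigma>_x: "\<sigma> (?e (xidx j)) = \<alpha> j" for j
  proof -
    have "(\<Sum>i\<in>UNIV. of_int (Poly_Mapping.lookup (?e (xidx j)) (xidx i)) * \<alpha> i) =
        (\<Sum>i\<in>UNIV. if i = j then \<alpha> j else 0)"
      by (intro sum.cong refl) (auto simp: lookup_single when_def)
    then show ?thesis by (simp add: \<sigma> lookup_single)
  qed
  have \<sigma>_y: "\<sigma> (?e 0) = \<beta>"
    by (simp add: \<sigma> lookup_one)
  have nil_top: "\<exists>n. \<sigma> u + of_nat n * \<sigma> w = 0"
    if "Poly_Mapping.keys (embed m Q p) \<subseteq> {..u}" "Poly_Mapping.lookup (embed m Q p) u \<noteq> 0" for u p
    using nil[of p] vfield_nilpotent_top[of K f, OF le that] by (auto simp: \<sigma>_def)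
  \<comment> \<open>If \<open>\<sigma> u\<close> is non-zero, the leading exponent \<open>u\<close>
    of an element of the subring is moved to \<open>w + u\<close>. The image lies in the subring
    again, so \<open>w + u\<close> obeys the constraints on leading exponents.\<close>
  have in_B: "0 \<le> Poly_Mapping.lookup (w + u) 0 \<and>
      (\<forall>j. - (Poly_Mapping.lookup (w + u) 0 div int r * int (m j)) \<le> Poly_Mapping.lookup (w + u) (xidx j))"
    if u: "Poly_Mapping.keys (embed m Q p) \<subseteq> {..u}" "Poly_Mapping.lookup (embed m Q p) u \<noteq> 0" "\<sigma> u \<noteq> 0" for u p
  proof -
    obtain q where q: "vfield K f (embed m Q p) = embed m Q q"
      using stable by blast
    have keys: "Poly_Mapping.keys (embed m Q q) \<subseteq> {..w + u}"
      using vfield_top(1)[of K f, OF le u(1)] by (simp add: q)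
    have top: "w + u \<in> Poly_Mapping.keys (embed m Q q)"
      using vfield_top(2)[of K f, OF le u(1)] u(2,3) by (simp add: q \<sigma>_def in_keys_iff)
    have "0 < r" using Q(3) by simp
    then show ?thesis
      using embed_lead_exp[OF Q(1,2) _ keys top] by blast
  qed
  let ?x = "\<lambda>j. [:[:cvar j:]:] :: 'n cpoly poly poly" and ?y = "[:[:0, 1:]:] :: 'n cpoly poly poly"
    and ?z = "[:0, 1:] :: 'n cpoly poly poly"
  have x: "Poly_Mapping.keys (embed m Q (?x j)) \<subseteq> {..?e (xidx j)}"
      "Poly_Mapping.lookup (embed m Q (?x j)) (?e (xidx j)) \<noteq> 0" for j
    unfolding embed_cvar_const by simp_all
  have "embed m Q ?y = Poly_Mapping.single (?e 0) 1"
    by (rule trans[OF embed_y laurent_y_def])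
  then have y: "Poly_Mapping.keys (embed m Q ?y) \<subseteq> {..?e 0}"
      "Poly_Mapping.lookup (embed m Q ?y) (?e 0) \<noteq> 0"
    by simp_all
  have z: "Poly_Mapping.keys (embed m Q ?z) \<subseteq> {..lead_exp m r 0 1}"
      "Poly_Mapping.lookup (embed m Q ?z) (lead_exp m r 0 1) \<noteq> 0"
    using topform_monomial[OF topform_laurent_z[OF Q(1), of m]] unfolding embed_z Q(2) by simp_all
  have "\<forall>j. \<exists>n. \<alpha> j + of_nat n * \<sigma> w = 0"
    using nil_top[OF x] by (simp add: \<sigma>_x)
  then obtain \<nu> where \<nu>: "\<And>j. \<alpha> j + of_nat (\<nu> j) * \<sigma> w = 0"
    by metis
  obtain \<mu> where \<mu>: "\<beta> + of_nat \<mu> * \<sigma> w = 0"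
    using nil_top[OF y] unfolding \<sigma>_y by blast
  obtain \<zeta> where \<zeta>: "\<sigma> (lead_exp m r 0 1) + of_nat \<zeta> * \<sigma> w = 0"
    using nil_top[OF z] by blast
  \<comment> \<open>All values of \<sigma> become integer multiples of \<open>\<sigma> w\<close>,
    which reduces complex identities to integer ones.\<close>
  have \<alpha>: "\<alpha> j = - of_nat (\<nu> j) * \<sigma> w" for j
    using \<nu>[of j] by (simp add: eq_neg_iff_add_eq_0)
  have \<beta>: "\<beta> = - of_nat \<mu> * \<sigma> w"
    using \<mu> by (simp add: eq_neg_iff_add_eq_0)
  \<comment> \<open>Otherwise every coefficient at \<open>w\<close> would vanish, although
    \<open>w\<close> occurs in some \<open>f k\<close>.\<close>
  have \<sigma>w: "\<sigma> w \<noteq> 0"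
  proof
    assume "\<sigma> w = 0"
    then have "\<And>j. \<alpha> j = 0" "\<beta> = 0" by (simp_all add: \<alpha> \<beta>)
    with \<open>w \<in> W\<close> show False
      by (auto simp: W_def K_def \<alpha>_def \<beta>_def in_keys_iff)
  qed
  \<comment> \<open>Evaluating \<sigma> at \<open>w\<close> itself and dividing by
    \<open>\<sigma> w\<close> yields \<open>t = - 1\<close>.\<close>
  define t where "t = Poly_Mapping.lookup w 0 * int \<mu> +
      (\<Sum>j\<in>UNIV. Poly_Mapping.lookup w (xidx j) * int (\<nu> j))"
  have "of_int (Poly_Mapping.lookup w 0) * \<beta> +
      (\<Sum>j\<in>UNIV. of_int (Poly_Mapping.lookup w (xidx j)) * \<alpha> j) = - (\<sigma> w * of_int t)"
    by (simp add: t_def \<alpha> \<beta> algebra_simps sum_distrib_left sum_negf)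
  then have "\<sigma> w = - (\<sigma> w * of_int t)"
    using \<sigma>[of w] by (rule trans[rotated])
  then have "\<sigma> w * of_int (1 + t) = 0"
    by (simp add: distrib_left eq_neg_iff_add_eq_0)
  with \<sigma>w have "1 + t = 0"
    by (metis mult_eq_0_iff of_int_eq_0_iff)
  then have eq_w: "Poly_Mapping.lookup w 0 * int \<mu> +
      (\<Sum>j\<in>UNIV. Poly_Mapping.lookup w (xidx j) * int (\<nu> j)) = - 1"
    unfolding t_def by linarith
  \<comment> \<open>The same division at the leading exponent of \<open>z\<close> identifies its
    nilpotency order \<zeta>.\<close>
  define z where "z = int r * int \<mu> - (\<Sum>j\<in>UNIV. int (m j) * int (\<nu> j))"
  have "\<sigma> (lead_exp m r 0 1) = of_nat r * \<beta> - (\<Sum>j\<in>UNIV. of_nat (m j) * \<alpha> j)"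
    by (simp add: \<sigma> sum_negf)
  also have "\<dots> = - (\<sigma> w * of_int z)"
    by (simp add: z_def \<alpha> \<beta> algebra_simps sum_distrib_left sum_negf)
  finally have "\<sigma> w * of_int (int \<zeta> - z) = 0"
    using \<zeta> by (simp add: algebra_simps)
  with \<sigma>w have "int \<zeta> - z = 0"
    by (metis mult_eq_0_iff of_int_eq_0_iff)
  then have eq_\<zeta>: "int \<zeta> = int r * int \<mu> - (\<Sum>j\<in>UNIV. int (m j) * int (\<nu> j))"
    unfolding z_def by linarith
  have x_B: "0 \<le> Poly_Mapping.lookup w 0 \<and> (\<forall>k. - (Poly_Mapping.lookup w 0 div int r * int (m k)) \<le>
      Poly_Mapping.lookup w (xidx k) + (if k = j then 1 else 0))" if "int (\<nu> j) \<noteq> 0" for j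
    using in_B[OF x, of j] that \<sigma>w
    by (auto simp: \<sigma>_x \<alpha> lookup_add lookup_single when_def eq_commute[of j])
  have y_B: "- ((Poly_Mapping.lookup w 0 + 1) div int r * int (m j)) \<le> Poly_Mapping.lookup w (xidx j)"
    if "int \<mu> \<noteq> 0" for j
    using in_B[OF y, unfolded \<sigma>_y] that \<sigma>w by (auto simp: \<beta> lookup_add lookup_one)
  have w0: "Poly_Mapping.lookup w 0 = - 1"
  proof (rule demazure_root_unique[OF _ _ _ _ _ eq_\<zeta> eq_w])
    show "2 \<le> int (m j)" for j using m[of j] by simp
    show "0 \<le> Poly_Mapping.lookup w 0" "- (Poly_Mapping.lookup w 0 div int r * int (m j))
        \<le> Poly_Mapping.lookup w (xidx j) + 1" if "int (\<nu> j) \<noteq> 0" for j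
      using x_B[OF that] by (auto dest: spec[of _ j])
    show "- (Poly_Mapping.lookup w 0 div int r * int (m k)) \<le> Poly_Mapping.lookup w (xidx k)"
      if "int (\<nu> j) \<noteq> 0" "k \<noteq> j" for j k
      using x_B[OF that(1)] that(2) by (auto dest: spec[of _ k])
  qed (use Q(3) y_B in simp_all)
  \<comment> \<open>The value on \<open>x_i\<close> is a non-zero element of the subring all of
    whose exponents have y-degree at most \<open>-1\<close>, against the bound \<open>0\<close> for
    leading exponents.\<close>
  obtain q where q: "vfield K f (embed m Q (?x i)) = embed m Q q"
    using stable by blast
  have "embed m Q q = f (xidx i) * Poly_Mapping.single (?e (xidx i)) 1"
    unfolding q[symmetric] embed_cvar_const by (rule vfield_monomial[OF finK xK])
  with fi have "embed m Q q \<noteq> 0" by simp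
  then have ne: "Poly_Mapping.keys (embed m Q q) \<noteq> {}" by simp
  define u where "u = Max (Poly_Mapping.keys (embed m Q q))"
  have u: "u \<in> Poly_Mapping.keys (embed m Q q)"
    unfolding u_def using ne by (rule Max_in[OF finite_keys])
  have "0 \<le> Poly_Mapping.lookup u 0"
    using embed_lead_exp(1)[OF Q(1,2) _ _ u] Q(3) by (simp add: u_def subset_eq)
  moreover have "u \<le> w + ?e (xidx i)"
    using vfield_top(1)[of K f, OF le x(1)[of i], unfolded q] u by blast
  then have "Poly_Mapping.lookup u 0 \<le> - 1"
    using poly_mapping_le_lookup_0[of u "w + ?e (xidx i)"] by (simp add: lookup_add lookup_single w0)
  ultimately show False by simp
qed

section \<open>Derivations into the Laurent ring as vector fields\<close>

lemma monom_coeff_lookup: "monom_coeff (Poly_Mapping.lookup e) = Poly_Mapping.single e 1"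
proof -
  have "embed_coeff (monom_coeff (Poly_Mapping.lookup e) - Poly_Mapping.single e 1) = 0"
    by (simp add: embed_coeff.hom_diff embed_monom_coeff embed_coeff_single)
  then show ?thesis by simp
qed

lemma cpoly_induct [case_names const var add mult]:
  fixes p :: "'n::finite cpoly"
  assumes const: "\<And>c. P (cconst c)" and var: "\<And>i. P (cvar i)"
    and add: "\<And>p q. P p \<Longrightarrow> P q \<Longrightarrow> P (p + q)"
    and mult: "\<And>p q. P p \<Longrightarrow> P q \<Longrightarrow> P (p * q)"
  shows "P p"
proof (induction p rule: poly_mapping_single_induct)
  case (single e c)
  have one: "P 1"
    using const[of 1] by (simp add: cconst_def)
  have pow: "P (p ^ n)" if "P p" for p n
    by (induction n) (use that one mult in simp_all)
  have "P (\<Prod>i\<in>A. cvar i ^ k i)" for A k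
    by (induction A rule: infinite_finite_induct) (use one mult pow var in simp_all)
  then have "P (monom_coeff (Poly_Mapping.lookup e))"
    by (simp add: monom_coeff_def)
  with const mult have "P (cconst c * Poly_Mapping.single e 1)"
    by (simp add: monom_coeff_lookup)
  then show ?case
    by (simp add: cconst_def mult_single)
qed (rule add)

text \<open>
  A derivation of the coordinate ring with values in the Laurent ring, here pulled back to
  \<open>\<complex>[x, y, z]\<close>, is determined by its values on the \<open>x\<^sub>i\<close> and \<open>y\<close>, since \<open>x\<^sup>m\<close> is invertible
  in the Laurent ring.
\<close>

lemma derivation_eq_vfield:
  fixes m :: "'n::finite \<Rightarrow> nat" and D :: "'n cpoly poly poly \<Rightarrow> laurent"
  assumes add: "\<And>p q. D (p + q) = D p + D q"
    and mult: "\<And>p q. D (p * q) = D p * embed m Q q + embed m Q p * D q"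
    and const: "\<And>c. D [:[:cconst c:]:] = 0"
    and eq: "D (danielewski_eq m Q) = 0"
  obtains f where "\<And>p. D p = vfield (coords TYPE('n)) f (embed m Q p)"
proof -
  define K where "K = coords TYPE('n)"
  define xv where "xv = (\<lambda>i::'n. [:[:cvar i:]:])"
  have fin: "finite K" by (simp add: K_def)
  have "inj (xidx :: 'n \<Rightarrow> nat)" by (simp add: inj_on_def)
  \<comment> \<open>The operator \<open>euler k\<close> reproduces the \<open>k\<close>-th
    coordinate, so the coefficient is the value of \<open>D\<close> there divided by the
    coordinate.\<close>
  define f where "f k = (if k = 0 then D [:[:0, 1:]:] else D (xv (inv_into UNIV xidx k))) *
      Poly_Mapping.single (Poly_Mapping.single k (- 1)) 1" for k
  define d where "d p = D p - vfield K f (embed m Q p)" for p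
  have d_add: "d (p + q) = d p + d q" for p q
    by (simp add: d_def add embed.hom_add vfield_add)
  have d_mult: "d (p * q) = d p * embed m Q q + embed m Q p * d q" for p q
    by (simp add: d_def mult embed.hom_mult vfield_times algebra_simps)
  have cancel: "f k * Poly_Mapping.single (Poly_Mapping.single k 1) 1 =
      (if k = 0 then D [:[:0, 1:]:] else D (xv (inv_into UNIV xidx k)))" for k
    by (simp add: f_def mult.assoc mult_single flip: single_add)
  have d_const: "d [:[:cconst c:]:] = 0" for c
    by (simp add: d_def const embed_cconst vfield_def euler_single)
  have d_var: "d (xv i) = 0" for i
    using vfield_monomial[OF fin, of "xidx i" f 1] \<open>inj xidx\<close>
    by (simp add: d_def xv_def embed_cvar K_def cancel)
  have d_coeff: "d [:[:c:]:] = 0" for c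
  proof (induction c rule: cpoly_induct)
    case (add p q)
    then show ?case using d_add[of "[:[:p:]:]" "[:[:q:]:]"] by simp
  next
    case (mult p q)
    then show ?case using d_mult[of "[:[:p:]:]" "[:[:q:]:]"] by simp
  qed (use d_const d_var in \<open>simp_all add: xv_def\<close>)
  have "vfield K f laurent_y = D [:[:0, 1:]:]"
    using vfield_monomial[OF fin, of 0 f 1] cancel[of 0]
    by (simp add: laurent_y_def K_def del: single_one)
  then have d_y: "d [:[:0, 1:]:] = 0"
    by (simp add: d_def embed_y del: embed_xy.eval_pCons)
  have d_xy: "d [:q:] = 0" for q
  proof (induction q)
    case 0
    show ?case using d_coeff[of 0] by simp
  next
    case (pCons c q)
    have "[:pCons c q:] = [:[:c:]:] + [:[:0, 1:]:] * [:q:]"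
      by simp
    then show ?case
      by (simp only: d_add d_mult d_coeff d_y pCons.IH) simp
  qed
  \<comment> \<open>Applying \<open>d\<close> to the equation leaves only \<open>x^m\<close> times
    \<open>d z\<close>; since \<open>x^m\<close> is non-zero in a domain, \<open>d z\<close>
    vanishes.\<close>
  have "danielewski_eq m Q = [:[:monom_coeff m:]:] * [:0, 1:] + [:- Q:]"
    by (simp add: danielewski_eq_alt)
  then have "d (danielewski_eq m Q) = embed_coeff (monom_coeff m) * d [:0, 1:]"
    by (simp only: d_add d_mult d_xy) simp
  moreover have "vfield K f 0 = 0"
    using vfield_add[of K f 0 0] by simp
  then have "d (danielewski_eq m Q) = 0"
    by (simp add: d_def eq)
  ultimately have d_z: "d [:0, 1:] = 0"
    by (simp add: embed_monom_coeff)
  have "d p = 0" for p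
  proof (induction p)
    case 0
    show ?case using d_xy[of 0] by simp
  next
    case (pCons q p)
    have "pCons q p = [:q:] + [:0, 1:] * p"
      by simp
    then show ?case
      by (simp only: d_add d_mult d_xy d_z pCons.IH) simp
  qed
  then have "D p = vfield K f (embed m Q p)" for p
    by (simp add: d_def)
  then show thesis
    by (intro that[of f]) (simp add: K_def)
qed

text \<open>Only the Euler operator of \<open>y\<close> remains, and it kills every monomial free of
  \<open>y\<close>.\<close>

lemma vfield_embed_coeff_eq_0:
  fixes c :: "'n::finite cpoly"
  assumes "\<And>i. f (xidx (i :: 'n)) = 0"
  shows "vfield (coords TYPE('n)) f (embed_coeff c) = 0"
proof -
  have "Poly_Mapping.lookup (embed_coeff c) u * of_int (Poly_Mapping.lookup u 0) = 0" for u
    using keys_embed_coeff_subset[of c] by (cases "u \<in> Poly_Mapping.keys (embed_coeff c)") (auto simp: in_keys_iff)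
  then have "euler 0 (embed_coeff c) = 0"
    by (intro poly_mapping_eqI) (simp add: lookup_euler mult.commute)
  then show ?thesis
    by (simp add: vfield_def sum_coords assms)
qed

section \<open>The coordinate ring\<close>

lemma ring_of_type_algebra_simps:
  "carrier ring_of_type_algebra = UNIV"
  "x \<otimes>\<^bsub>ring_of_type_algebra\<^esub> y = x * y"
  "x \<oplus>\<^bsub>ring_of_type_algebra\<^esub> y = x + y"
  "\<one>\<^bsub>ring_of_type_algebra\<^esub> = 1"
  "\<zero>\<^bsub>ring_of_type_algebra\<^esub> = 0"
  by (simp_all add: ring_of_type_algebra_def)

lemma ring_of_type_algebra_minus:
  "x \<ominus>\<^bsub>ring_of_type_algebra\<^esub> y = x - (y :: 'a::comm_ring_1)"
proof -
  interpret cring "ring_of_type_algebra :: 'a ring" by (rule cring_from_type_algebra)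
  have "\<ominus>\<^bsub>ring_of_type_algebra\<^esub> y = - y"
    by (rule minus_equality) (simp_all add: ring_of_type_algebra_simps)
  then show ?thesis by (simp add: a_minus_def ring_of_type_algebra_simps)
qed

locale danielewski =
  fixes m :: "'n::finite \<Rightarrow> nat" and Q :: "'n cpoly poly"
  assumes exponents: "m i > 1" and monic: "lead_coeff Q = 1" and degree_ge_2: "2 \<le> Polynomial.degree Q"
begin

abbreviation B where "B \<equiv> danielewski_ring m Q"

definition cls :: "'n cpoly poly poly \<Rightarrow> 'n cpoly poly poly set"
  where "cls p = danielewski_ideal m Q +>\<^bsub>ring_of_type_algebra\<^esub> p"

lemma carrier_B: "carrier B = range cls"
  by (auto simp: danielewski_ring_def FactRing_def A_RCOSETS_def' cls_def ring_of_type_algebra_simps)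

lemma cls_in_B [simp]: "cls p \<in> carrier B"
  by (simp add: carrier_B)

lemma cls_ring_hom: "cls \<in> ring_hom ring_of_type_algebra B"
  unfolding cls_def[abs_def] danielewski_ring_def by (rule ideal.rcos_ring_hom[OF danielewski_ideal])

lemma cls_hom:
  "cls (p + q) = cls p \<oplus>\<^bsub>B\<^esub> cls q" "cls (p * q) = cls p \<otimes>\<^bsub>B\<^esub> cls q"
  "cls 1 = \<one>\<^bsub>B\<^esub>" "cls 0 = \<zero>\<^bsub>B\<^esub>"
proof -
  have "ring (ring_of_type_algebra :: 'n cpoly poly poly ring)" "ring B"
    using cring_from_type_algebra cring_danielewski_ring by (auto intro: cring.axioms(1))
  from ring_hom_zero[OF cls_ring_hom this] show "cls 0 = \<zero>\<^bsub>B\<^esub>"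
    by (simp add: ring_of_type_algebra_simps)
qed (use cls_ring_hom in \<open>simp_all add: ring_hom_def ring_of_type_algebra_simps\<close>)

lemma cls_eq_iff_dvd: "cls p = cls q \<longleftrightarrow> danielewski_eq m Q dvd p - q"
proof -
  interpret cring "ring_of_type_algebra :: 'n cpoly poly poly ring" by (rule cring_from_type_algebra)
  have "cls p = cls q \<longleftrightarrow> p - q \<in> danielewski_ideal m Q"
    unfolding cls_def using quotient_eq_iff_same_a_r_cos[OF danielewski_ideal, of p q]
    by (simp add: ring_of_type_algebra_simps ring_of_type_algebra_minus)
  also have "\<dots> \<longleftrightarrow> danielewski_eq m Q dvd p - q"
    by (auto simp: danielewski_ideal_def cgenideal_def ring_of_type_algebra_simps dvd_def mult.commute)
  finally show ?thesis .
qed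

lemma cls_eq_iff: "cls p = cls q \<longleftrightarrow> embed m Q p = embed m Q q"
  using embed_eq_0_iff[OF monic, of m "p - q"] degree_ge_2
  by (simp add: cls_eq_iff_dvd embed.hom_diff)

text \<open>The induced injection of the coordinate ring into the Laurent ring; by
  \<open>cls_eq_iff\<close> the chosen representative is immaterial.\<close>

definition lift :: "'n cpoly poly poly set \<Rightarrow> laurent"
  where "lift a = embed m Q (SOME p. cls p = a)"

lemma lift_cls [simp]: "lift (cls p) = embed m Q p"
  unfolding lift_def cls_eq_iff[symmetric] by (rule someI) (rule refl)

lemma lift_hom:
  assumes "a \<in> carrier B" "b \<in> carrier B"
  shows "lift (a \<oplus>\<^bsub>B\<^esub> b) = lift a + lift b" "lift (a \<otimes>\<^bsub>B\<^esub> b) = lift a * lift b"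
  using assms by (auto simp: carrier_B embed.hom_add embed.hom_mult simp flip: cls_hom)

lemma lift_zero [simp]: "lift \<zero>\<^bsub>B\<^esub> = 0"
  by (simp add: embed.hom_zero flip: cls_hom)

lemma lift_eq_iff:
  assumes "a \<in> carrier B" "b \<in> carrier B"
  shows "lift a = lift b \<longleftrightarrow> a = b"
  using assms unfolding carrier_B by (auto simp: cls_eq_iff[symmetric])

lemma danielewski_const_eq_cls: "danielewski_const m Q c = cls [:[:cconst c:]:]"
  by (simp add: danielewski_const_def cls_def)

lemma B_closed:
  assumes "a \<in> carrier B" "b \<in> carrier B"
  shows "a \<oplus>\<^bsub>B\<^esub> b \<in> carrier B" "a \<otimes>\<^bsub>B\<^esub> b \<in> carrier B"
  using assms by (auto simp: carrier_B simp flip: cls_hom)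

lemma zero_in_B: "\<zero>\<^bsub>B\<^esub> \<in> carrier B"
  by (simp flip: cls_hom)

text \<open>Seen in the Laurent ring, \<delta> is a vector field by
  \<open>derivation_eq_vfield\<close>, and its x-components vanish by
  \<open>vfield_locally_nilpotent_x\<close>.\<close>

lemma locally_nilpotent_derivation_coeff:
  assumes der: "complex_derivation (danielewski_const m Q) B \<delta>" and nil: "locally_nilpotent B \<delta>"
  shows "\<delta> (cls [:[:c:]:]) = \<zero>\<^bsub>B\<^esub>"
proof -
  have closed: "\<delta> a \<in> carrier B" if "a \<in> carrier B" for a
    using der that by (auto simp: complex_derivation_def)
  have der_add: "\<delta> (a \<oplus>\<^bsub>B\<^esub> b) = \<delta> a \<oplus>\<^bsub>B\<^esub> \<delta> b"
    and der_mult: "\<delta> (a \<otimes>\<^bsub>B\<^esub> b) = (\<delta> a \<otimes>\<^bsub>B\<^esub> b) \<oplus>\<^bsub>B\<^esub> (a \<otimes>\<^bsub>B\<^esub> \<delta> b)"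
    if "a \<in> carrier B" "b \<in> carrier B" for a b
    using der that by (simp_all add: complex_derivation_def)
  have der_const: "\<delta> (danielewski_const m Q e \<otimes>\<^bsub>B\<^esub> a) = danielewski_const m Q e \<otimes>\<^bsub>B\<^esub> \<delta> a"
    if "a \<in> carrier B" for e a
    using der that by (simp add: complex_derivation_def)
  define D where "D p = lift (\<delta> (cls p))" for p
  have D_add: "D (p + q) = D p + D q" for p q
    by (simp add: D_def cls_hom der_add lift_hom closed)
  have D_mult: "D (p * q) = D p * embed m Q q + embed m Q p * D q" for p q
    by (simp add: D_def cls_hom der_mult lift_hom closed B_closed)
  have "D 1 = 0"
    using D_mult[of 1 1] by (simp add: embed.hom_one)
  have D_const: "D [:[:cconst e:]:] = 0" for e
  proof -
    have "D ([:[:cconst e:]:] * 1) = embed m Q [:[:cconst e:]:] * D 1"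
      unfolding D_def cls_hom(2) danielewski_const_eq_cls[symmetric]
      by (subst der_const) (simp_all add: danielewski_const_eq_cls lift_hom closed)
    with \<open>D 1 = 0\<close> show ?thesis by simp
  qed
  have "D 0 = 0"
    using D_add[of 0 0] by simp
  moreover have "cls (danielewski_eq m Q) = cls 0"
    by (simp add: cls_eq_iff_dvd)
  ultimately have "D (danielewski_eq m Q) = 0"
    by (simp add: D_def)
  then obtain f where f: "\<And>p. D p = vfield (coords TYPE('n)) f (embed m Q p)"
    using derivation_eq_vfield[OF D_add D_mult D_const] by blast
  have lift_der: "lift (\<delta> a) = vfield (coords TYPE('n)) f (lift a)" if "a \<in> carrier B" for a
    using that f by (auto simp: carrier_B D_def)
  have pow: "(\<delta> ^^ n) a \<in> carrier B \<and> lift ((\<delta> ^^ n) a) = (vfield (coords TYPE('n)) f ^^ n) (lift a)"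
    if "a \<in> carrier B" for n a
    by (induction n) (use that in \<open>simp_all add: lift_der closed\<close>)
  have "f (xidx (i :: 'n)) = 0" for i
  proof (rule vfield_locally_nilpotent_x[OF exponents monic refl degree_ge_2])
    fix p
    obtain q where "\<delta> (cls p) = cls q"
      using closed[OF cls_in_B, of p] by (auto simp: carrier_B)
    then show "vfield (coords TYPE('n)) f (embed m Q p) \<in> range (embed m Q)"
      using lift_der[OF cls_in_B, of p] by (metis lift_cls rangeI)
    obtain n where "(\<delta> ^^ n) (cls p) = \<zero>\<^bsub>B\<^esub>"
      using nil cls_in_B unfolding locally_nilpotent_def by blast
    then show "\<exists>n. (vfield (coords TYPE('n)) f ^^ n) (embed m Q p) = 0"
      using pow[of "cls p" n] by auto
  qed
  then have "lift (\<delta> (cls [:[:c:]:])) = lift \<zero>\<^bsub>B\<^esub>"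
    by (simp add: lift_der vfield_embed_coeff_eq_0)
  then show ?thesis
    by (subst (asm) lift_eq_iff) (simp_all add: closed zero_in_B)
qed

section \<open>A locally nilpotent derivation whose kernel is the polynomial ring in the x_i\<close>

text \<open>The derivation \<open>x\<^sup>m \<partial>/\<partial>y\<close> of the Laurent ring.\<close>

definition dy :: "laurent \<Rightarrow> laurent"
  where "dy b = Poly_Mapping.single (xexp (\<lambda>i. int (m i)) - Poly_Mapping.single 0 1) 1 * euler 0 b"

lemma dy_add: "dy (b + c) = dy b + dy c"
  by (simp add: dy_def euler_add algebra_simps)

lemma dy_mult: "dy (b * c) = dy b * c + b * dy c"
  by (simp add: dy_def euler_times algebra_simps)

lemma dy_eq_0_iff: "dy b = 0 \<longleftrightarrow> (\<forall>u\<in>Poly_Mapping.keys b. Poly_Mapping.lookup u 0 = 0)"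
proof -
  have "dy b = 0 \<longleftrightarrow> (\<forall>u. Poly_Mapping.lookup (euler 0 b) u = 0)"
    by (auto simp: dy_def intro: poly_mapping_eqI)
  then show ?thesis
    by (auto simp: lookup_euler in_keys_iff)
qed

lemma dy_embed_coeff: "dy (embed_coeff c) = 0"
  using topform_embed_coeff[of c] by (simp add: dy_eq_0_iff topform_refl_iff)

lemma dy_laurent_y: "dy laurent_y = embed_coeff (monom_coeff m)"
proof -
  have "euler 0 laurent_y = laurent_y"
    unfolding laurent_y_def euler_single by simp
  moreover have "Poly_Mapping.single (xexp (\<lambda>i. int (m i)) - Poly_Mapping.single 0 1) 1 * laurent_y =
      embed_coeff (monom_coeff m)"
    unfolding laurent_y_def embed_monom_coeff mult_single by simp
  ultimately show ?thesis by (simp add: dy_def)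
qed

text \<open>The cofactor is the image of the partial derivative of \<open>q\<close> by
  \<open>y\<close>. The factor \<open>x^m\<close> will cancel the denominator of
  \<open>laurent_z m Q\<close>.\<close>

lemma dy_embed_xy:
  "\<exists>q' :: 'n cpoly poly. dy (embed_xy q) = embed_coeff (monom_coeff m) * embed_xy q'"
  for q :: "'n cpoly poly"
proof (induction q)
  case 0
  show ?case
    using dy_embed_coeff[of 0] by (intro exI[of _ 0]) (simp add: embed_coeff.hom_zero)
next
  case (pCons c q)
  then obtain q' :: "'n cpoly poly" where "dy (embed_xy q) = embed_coeff (monom_coeff m) * embed_xy q'" by blast
  \<comment> \<open>The witness is the product rule for \<open>c + y q\<close>.\<close>
  then have "dy (embed_xy (pCons c q)) = embed_coeff (monom_coeff m) * embed_xy (q + pCons 0 q')"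
    by (simp add: dy_add dy_mult dy_embed_coeff dy_laurent_y embed_coeff.eval_add
        embed_coeff.hom_zero algebra_simps)
  then show ?case by blast
qed

lemma dy_laurent_z: "\<exists>q' :: 'n cpoly poly. dy (laurent_z m Q) = embed_xy q'"
proof -
  obtain q' :: "'n cpoly poly" where q': "dy (embed_xy Q) = embed_coeff (monom_coeff m) * embed_xy q'"
    using dy_embed_xy by blast
  have "dy (Poly_Mapping.single (xexp (\<lambda>i. - int (m i))) 1) = 0"
    by (simp add: dy_eq_0_iff)
  then have "dy (laurent_z m Q) = Poly_Mapping.single (xexp (\<lambda>i. - int (m i))) 1 *
      embed_coeff (monom_coeff m) * embed_xy q'"
    by (simp add: laurent_z_def dy_mult q' mult.assoc)
  also have "Poly_Mapping.single (xexp (\<lambda>i. - int (m i))) 1 * embed_coeff (monom_coeff m) = 1"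
    by (simp add: embed_monom_coeff mult_single flip: xexp_add)
  finally show ?thesis by auto
qed

lemma dy_stable: "dy (embed m Q p) \<in> range (embed m Q)"
proof (induction p)
  case 0
  have "dy 0 = 0" using dy_add[of 0 0] by simp
  then show ?case by (auto intro: range_eqI[of _ _ 0])
next
  case (pCons q p)
  then obtain p' where p': "dy (embed m Q p) = embed m Q p'" by blast
  obtain q' z' :: "'n cpoly poly" where "dy (embed_xy q) = embed_coeff (monom_coeff m) * embed_xy q'"
      "dy (laurent_z m Q) = embed_xy z'"
    using dy_embed_xy dy_laurent_z by blast
  then have "dy (embed m Q (pCons q p)) =
      embed m Q ([:[:monom_coeff m:]:] * [:q':] + [:z':] * p + [:0, 1:] * p')"
    unfolding embed.hom_add embed.hom_mult embed_z by (simp add: dy_add dy_mult p')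
  then show ?case by blast
qed

text \<open>The \<open>x_i\<close>, \<open>y\<close> and \<open>x^(-m) Q\<close> have no negative
  power of \<open>y\<close>, and this property survives sums and products.\<close>

lemma keys_embed_nonneg:
  assumes "u \<in> Poly_Mapping.keys (embed m Q p)"
  shows "0 \<le> Poly_Mapping.lookup u 0"
proof -
  define N :: "laurent set" where "N = {b. \<forall>u\<in>Poly_Mapping.keys b. 0 \<le> Poly_Mapping.lookup u 0}"
  have add: "b + c \<in> N" if "b \<in> N" "c \<in> N" for b c
    using that keys_add[of b c] by (auto simp: N_def)
  have mult: "b * c \<in> N" if "b \<in> N" "c \<in> N" for b c
    using that keys_mult[of b c] by (fastforce simp: N_def lookup_add)
  have zero: "0 \<in> N" by (simp add: N_def)
  have coeff: "embed_coeff c \<in> N" for c :: "'n cpoly"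
    using topform_embed_coeff[of c] by (simp add: N_def topform_refl_iff)
  have "laurent_y \<in> N"
    by (simp add: N_def laurent_y_def lookup_one)
  then have xy: "embed_xy q \<in> N" for q :: "'n cpoly poly"
    by (induction q) (simp_all add: zero coeff add mult)
  moreover have "Poly_Mapping.single (xexp (\<lambda>i. - int (m i))) 1 \<in> N"
    by (simp add: N_def)
  ultimately have "laurent_z m Q \<in> N"
    by (simp add: laurent_z_def mult)
  then have "embed m Q p \<in> N"
    by (induction p) (simp_all add: zero xy add mult)
  with assms show ?thesis by (simp add: N_def)
qed

text \<open>Each application kills the terms of y-degree \<open>0\<close> and lowers the y-degree of
  the others by one.\<close>

lemma dy_nilpotent:
  assumes "\<And>u. u \<in> Poly_Mapping.keys b \<Longrightarrow> 0 \<le> Poly_Mapping.lookup u 0 \<and> Poly_Mapping.lookup u 0 < int n"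
  shows "(dy ^^ n) b = 0"
  using assms
proof (induction n arbitrary: b)
  case 0
  then have "Poly_Mapping.keys b = {}" by fastforce
  then show ?case by simp
next
  case (Suc n)
  have "(dy ^^ n) (dy b) = 0"
  proof (rule Suc.IH)
    fix u
    assume "u \<in> Poly_Mapping.keys (dy b)"
    then obtain v where v: "v \<in> Poly_Mapping.keys (euler 0 b)"
        "u = xexp (\<lambda>i. int (m i)) - Poly_Mapping.single 0 1 + v"
      using keys_mult[of "Poly_Mapping.single (xexp (\<lambda>i. int (m i)) - Poly_Mapping.single 0 1) 1" "euler 0 b"]
      by (auto simp: dy_def)
    then have "v \<in> Poly_Mapping.keys b" "Poly_Mapping.lookup v 0 \<noteq> 0"
      by (auto simp: in_keys_iff lookup_euler)
    with Suc.prems[of v] v(2)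
    show "0 \<le> Poly_Mapping.lookup u 0 \<and> Poly_Mapping.lookup u 0 < int n"
      by (auto simp: lookup_add lookup_minus lookup_one)
  qed
  then show ?case by (simp add: funpow_swap1)
qed

lemma dy_locally_nilpotent: "\<exists>n. (dy ^^ n) (embed m Q p) = 0"
proof -
  define M where "M = (\<lambda>u. Poly_Mapping.lookup u 0) ` Poly_Mapping.keys (embed m Q p)"
  have "finite M" by (simp add: M_def)
  then have "x < int (Suc (nat (Max M)))" if "x \<in> M" for x
    using Max_ge[of M x] that by linarith
  then have "(dy ^^ Suc (nat (Max M))) (embed m Q p) = 0"
    by (intro dy_nilpotent conjI keys_embed_nonneg) (auto simp: M_def)
  then show ?thesis by blast
qed

text \<open>The restriction of \<open>dy\<close> to the coordinate ring, possible by
  \<open>dy_stable\<close>. Its identities are verified after the injective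
  \<open>lift\<close>.\<close>

definition \<delta>0 :: "'n cpoly poly poly set \<Rightarrow> 'n cpoly poly poly set"
  where "\<delta>0 a = cls (SOME q. embed m Q q = dy (lift a))"

lemma lift_\<delta>0:
  assumes "a \<in> carrier B"
  shows "lift (\<delta>0 a) = dy (lift a)"
proof -
  obtain p where "a = cls p" using assms by (auto simp: carrier_B)
  then have "\<exists>q. embed m Q q = dy (lift a)"
    using dy_stable[of p] by auto
  then show ?thesis
    unfolding \<delta>0_def lift_cls by (rule someI_ex)
qed

lemma \<delta>0_closed [simp]: "\<delta>0 a \<in> carrier B"
  by (simp add: \<delta>0_def)

lemma complex_derivation_\<delta>0: "complex_derivation (danielewski_const m Q) B \<delta>0"
proof -
  have "\<delta>0 (a \<oplus>\<^bsub>B\<^esub> b) = \<delta>0 a \<oplus>\<^bsub>B\<^esub> \<delta>0 b" if "a \<in> carrier B" "b \<in> carrier B" for a b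
    using that by (subst lift_eq_iff[symmetric]) (simp_all add: B_closed lift_\<delta>0 lift_hom dy_add)
  moreover have "\<delta>0 (a \<otimes>\<^bsub>B\<^esub> b) = (\<delta>0 a \<otimes>\<^bsub>B\<^esub> b) \<oplus>\<^bsub>B\<^esub> (a \<otimes>\<^bsub>B\<^esub> \<delta>0 b)"
    if "a \<in> carrier B" "b \<in> carrier B" for a b
    using that by (subst lift_eq_iff[symmetric]) (simp_all add: B_closed lift_\<delta>0 lift_hom dy_mult)
  moreover have "\<delta>0 (danielewski_const m Q c \<otimes>\<^bsub>B\<^esub> a) = danielewski_const m Q c \<otimes>\<^bsub>B\<^esub> \<delta>0 a"
    if "a \<in> carrier B" for c a
    using that unfolding danielewski_const_eq_cls
    by (subst lift_eq_iff[symmetric])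
      (simp_all add: B_closed lift_\<delta>0 lift_hom dy_mult dy_embed_coeff)
  ultimately show ?thesis
    by (simp add: complex_derivation_def)
qed

lemma locally_nilpotent_\<delta>0: "locally_nilpotent B \<delta>0"
  unfolding locally_nilpotent_def
proof
  fix a
  assume a: "a \<in> carrier B"
  have pow: "(\<delta>0 ^^ n) a \<in> carrier B \<and> lift ((\<delta>0 ^^ n) a) = (dy ^^ n) (lift a)" for n
    by (induction n) (use a in \<open>simp_all add: lift_\<delta>0\<close>)
  obtain p where "a = cls p" using a by (auto simp: carrier_B)
  then obtain n where "(dy ^^ n) (lift a) = 0"
    using dy_locally_nilpotent by auto
  then have "lift ((\<delta>0 ^^ n) a) = lift \<zero>\<^bsub>B\<^esub>"
    using pow by simp
  then show "\<exists>k. (\<delta>0 ^^ k) a = \<zero>\<^bsub>B\<^esub>"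
    using pow[of n] lift_eq_iff[OF _ zero_in_B] by blast
qed

text \<open>An element killed by \<open>dy\<close> has y-degree \<open>0\<close> throughout. The
  y-degree \<open>r * k + l\<close> of its normal form, with \<open>r\<close> the degree of
  \<open>Q\<close>, is then \<open>0\<close>, and \<open>r > 0\<close> leaves neither
  \<open>z\<close> nor \<open>y\<close>.\<close>

lemma kernel_\<delta>0:
  assumes "a \<in> carrier B" "\<delta>0 a = \<zero>\<^bsub>B\<^esub>"
  shows "\<exists>c. a = cls [:[:c:]:]"
proof -
  obtain p where p: "a = cls p" using assms(1) by (auto simp: carrier_B)
  obtain p' where p': "normal_form (Polynomial.degree Q) p'" "danielewski_eq m Q dvd p - p'"
    using normal_form_exists[OF monic] degree_ge_2 by (metis gr0I not_numeral_le_zero)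
  then have a: "a = cls p'" by (simp add: p cls_eq_iff_dvd)
  have "dy (embed m Q p') = 0"
    using assms lift_\<delta>0[OF assms(1)] by (simp add: a)
  then have keys: "Poly_Mapping.lookup u 0 = 0" if "u \<in> Poly_Mapping.keys (embed m Q p')" for u
    using that by (simp add: dy_eq_0_iff)
  show ?thesis
  proof (cases "p' = 0")
    case True
    with a show ?thesis by (intro exI[of _ 0]) simp
  next
    case False
    obtain b where top: "topform (int (ydeg (Polynomial.degree Q) p')) (embed m Q p') b" and "b \<noteq> 0"
      using topform_embed[OF monic refl p'(1), of m] False by force
    then obtain u where u: "u \<in> Poly_Mapping.keys b" by fastforce
    then have u0: "Poly_Mapping.lookup u 0 = int (ydeg (Polynomial.degree Q) p')"
      using top by (simp add: topform_def)
    moreover have "u \<notin> Poly_Mapping.keys (embed m Q p' - b)"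
      using top u0 by (auto simp: topform_def)
    then have "u \<in> Poly_Mapping.keys (embed m Q p')"
      using u by (simp add: in_keys_iff lookup_minus)
    ultimately have "ydeg (Polynomial.degree Q) p' = 0"
      using keys[of u] by (metis of_nat_eq_0_iff)
    then have "Polynomial.degree p' = 0" "Polynomial.degree (coeff p' 0) = 0"
      using degree_ge_2 by auto
    then have "p' = [:[:coeff (coeff p' 0) 0:]:]"
      by (metis degree_0_id)
    with a show ?thesis by metis
  qed
qed

section \<open>The invariant and its isomorphism with the polynomial ring\<close>

lemma makar_limanov_eq:
  "makar_limanov (danielewski_const m Q) B = range (\<lambda>c. cls [:[:c:]:])"
proof
  show "makar_limanov (danielewski_const m Q) B \<subseteq> range (\<lambda>c. cls [:[:c:]:])"
    using kernel_\<delta>0 complex_derivation_\<delta>0 locally_nilpotent_\<delta>0 by (fastforce simp: makar_limanov_def)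
  show "range (\<lambda>c. cls [:[:c:]:]) \<subseteq> makar_limanov (danielewski_const m Q) B"
    by (auto simp: makar_limanov_def locally_nilpotent_derivation_coeff)
qed

lemma coeff_ring_iso:
  "(\<lambda>c. cls [:[:c:]:]) \<in> ring_iso ring_of_type_algebra
    (B\<lparr>carrier := makar_limanov (danielewski_const m Q) B\<rparr>)"
proof (rule ring_iso_memI)
  have "inj (\<lambda>c. cls [:[:c:]:])"
    by (auto intro!: injI simp: cls_eq_iff embed_coeff_eq_iff)
  then show "bij_betw (\<lambda>c. cls [:[:c:]:]) (carrier ring_of_type_algebra)
      (carrier (B\<lparr>carrier := makar_limanov (danielewski_const m Q) B\<rparr>))"
    by (simp add: makar_limanov_eq ring_of_type_algebra_simps bij_betw_def)
qed (simp_all add: makar_limanov_eq ring_of_type_algebra_simps one_pCons flip: cls_hom)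

end

theorem theorem2p8:
  fixes m :: "'n::finite \<Rightarrow> nat"
    and Q :: "'n cpoly poly"
    and r :: nat
  assumes "\<And>i. m i > 1"
    and "Polynomial.lead_coeff Q = 1"
    and "Polynomial.degree Q = r"
    and "r \<ge> 2"
  shows "\<exists>h. h \<in> ring_iso
            (danielewski_ring m Q
              \<lparr>carrier := makar_limanov (danielewski_const m Q) (danielewski_ring m Q)\<rparr>)
            (ring_of_type_algebra :: 'n cpoly ring) \<and>
          (\<forall>c. h (danielewski_const m Q c) = cconst c)"
proof -
  interpret danielewski m Q
    by unfold_locales (use assms in auto)
  let ?g = "\<lambda>c. cls [:[:c:]:]"
  let ?h = "inv_into (carrier ring_of_type_algebra) ?g"
  have "ring (ring_of_type_algebra :: 'n cpoly ring)"
    by (rule cring.axioms(1)[OF cring_from_type_algebra])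
  from ring_iso_set_sym[OF this coeff_ring_iso]
  have "?h \<in> ring_iso (B\<lparr>carrier := makar_limanov (danielewski_const m Q) B\<rparr>) ring_of_type_algebra" .
  \<comment> \<open>The structure map sends \<open>c\<close> to the class of
    \<open>cconst c\<close>, so the inverse of \<open>?g\<close> respects the complex
    scalars.\<close>
  moreover have "inj_on ?g (carrier ring_of_type_algebra)"
    using coeff_ring_iso by (auto simp: ring_iso_def bij_betw_def)
  then have "?h (danielewski_const m Q c) = cconst c" for c
    unfolding danielewski_const_eq_cls by (rule inv_into_f_f) (simp add: ring_of_type_algebra_simps)
  ultimately show ?thesis by blast
qed

end
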